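(* Let $n,k$ be integers with $n\ge k+1$ and $k\ge 5$. Then $ex_{\mathcal{P}}(n,\Theta_k^+)=ex_{\mathcal{P}}(n,\Theta_k)$.
   Context: All graphs are finite and simple. For an integer $k\ge 4$, a Theta graph on $k$ vertices is a graph obtained from the cycle $C_k$ by adding one chord; $\Theta_k$ denotes the family of all non-isomorphic Theta graphs on $k$ vertices. For a graph $H$, $H^+$ denotes the graph obtained from $H$ by adding exactly one pendant edge (joining a new vertex) to a vertex of degree two, and $\Theta_k^+=\{H^+ : H\in\Theta_k\}$. For a family $\mathcal{F}$, a graph is $\mathcal{F}$-free if it contains no member of $\mathcal{F}$ as a subgraph, and $ex_{\mathcal{P}}(n,\mathcal{F})$ is the maximum number of edges in an $\mathcal{F}$-free planar graph on $n$ vertices. *)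

theory Defs
  imports "HOL-Analysis.Analysis"
begin

type_synonym 'a graph = "'a set \<times> 'a set set"

abbreviation verts :: "'a graph \<Rightarrow> 'a set" where
  "verts G \<equiv> fst G"

abbreviation edges :: "'a graph \<Rightarrow> 'a set set" where
  "edges G \<equiv> snd G"

definition simple_graph :: "'a graph \<Rightarrow> bool" where
  "simple_graph G \<longleftrightarrow> finite (verts G) \<and> (\<forall>e\<in>edges G. e \<subseteq> verts G \<and> card e = 2)"

definition degree :: "'a graph \<Rightarrow> 'a \<Rightarrow> nat" where
  "degree G v = card {e \<in> edges G. v \<in> e}"

text \<open>\<open>contains G H\<close>: some (not necessarily induced) subgraph of \<open>G\<close> is isomorphic to \<open>H\<close>.\<close>

definition contains :: "'a graph \<Rightarrow> 'b graph \<Rightarrow> bool" where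
  "contains G H \<longleftrightarrow>
     (\<exists>f. inj_on f (verts H) \<and> f ` verts H \<subseteq> verts G \<and> (\<forall>e\<in>edges H. f ` e \<in> edges G))"

definition family_free :: "'b graph set \<Rightarrow> 'a graph \<Rightarrow> bool" where
  "family_free \<F> G \<longleftrightarrow> (\<forall>H\<in>\<F>. \<not> contains G H)"

text \<open>A graph is planar if it can be drawn in the plane: vertices are distinct points, each edge
  is a simple arc joining its two ends and passing through no other vertex, and distinct edges
  meet only at vertices (hence only at common ends).\<close>

definition planar :: "'a graph \<Rightarrow> bool" where
  "planar G \<longleftrightarrow>
     (\<exists>(p :: 'a \<Rightarrow> complex) (\<gamma> :: 'a set \<Rightarrow> real \<Rightarrow> complex).
        inj_on p (verts G) \<and>
        (\<forall>e\<in>edges G. arc (\<gamma> e) \<and>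
           {pathstart (\<gamma> e), pathfinish (\<gamma> e)} = p ` e \<and>
           path_image (\<gamma> e) \<inter> p ` verts G = p ` e) \<and>
        (\<forall>e\<in>edges G. \<forall>e'\<in>edges G. e \<noteq> e' \<longrightarrow>
           path_image (\<gamma> e) \<inter> path_image (\<gamma> e') \<subseteq> p ` verts G))"

definition is_cycle :: "nat \<Rightarrow> 'a graph \<Rightarrow> bool" where
  "is_cycle k C \<longleftrightarrow> k \<ge> 3 \<and>
     (\<exists>c. bij_betw c {..<k} (verts C) \<and> edges C = (\<lambda>i. {c i, c (Suc i mod k)}) ` {..<k})"

text \<open>Families of graphs up to isomorphism are represented by the isomorphism-closed sets of all
  their copies with natural-number vertices; \<^const>\<open>family_free\<close> only sees isomorphism types.\<close>

definition Theta :: "nat \<Rightarrow> nat graph set" where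
  "Theta k = {(verts C, insert {u, v} (edges C)) | C u v.
     is_cycle k C \<and> u \<in> verts C \<and> v \<in> verts C \<and> u \<noteq> v \<and> {u, v} \<notin> edges C}"

text \<open>All graphs \<open>H\<^sup>+\<close>, for every choice of the vertex of degree two.\<close>

definition pendant_extensions :: "'a graph \<Rightarrow> 'a graph set" where
  "pendant_extensions H = {(insert w (verts H), insert {v, w} (edges H)) | v w.
     v \<in> verts H \<and> degree H v = 2 \<and> w \<notin> verts H}"

definition Theta_plus :: "nat \<Rightarrow> nat graph set" where
  "Theta_plus k = (\<Union>H\<in>Theta k. pendant_extensions H)"

text \<open>The maximum is over a finite set of values, since a simple graph on \<open>n\<close> vertices has at
  most \<open>n choose 2\<close> edges; it is nonempty if every member of \<open>\<F>\<close> has an edge.\<close>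

definition ex_planar :: "nat \<Rightarrow> 'b graph set \<Rightarrow> nat" where
  "ex_planar n \<F> = Max {card (edges G) | G :: nat graph.
     simple_graph G \<and> card (verts G) = n \<and> planar G \<and> family_free \<F> G}"

end

theory Submission
  imports Defs "HOL-Complex_Analysis.Riemann_Mapping"
begin

text \<open>Let \<open>G\<close> be planar without members of \<open>\<Theta>\<^sub>k\<^sup>+\<close>, and let \<open>S\<close> carry a Theta graph. A vertex of \<open>S\<close> with a
  neighbour outside \<open>S\<close> lies on the chord of every Theta graph on \<open>S\<close>; if there are 0, 1 or 2 such
  vertices, \<open>S\<close> therefore spans at most \<open>3k - 6\<close> (the general planar bound), \<open>2k - 3\<close> or \<open>k + 1\<close>
  edges. The other vertices of \<open>S\<close> are deleted and, after induction, glued back at an arbitrary vertex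
  as triangulated blocks with at most \<open>k - 1\<close> vertices: no Theta graph arises, since it would
  be contained in a block, and at least as many edges are gained. The induction excludes \<open>k\<close> vertices;
  if deletion leaves just a second such set \<open>S'\<close>, everything is rebuilt from a single vertex.\<close>

text \<open>Edges are arbitrary arcs, so neither faces nor Euler's formula enter; topology is used
  for two facts only. The bound \<open>3k - 6\<close> rests on the nonplanarity of
  \<open>K_5\<close> alone, as Mader's contraction argument never meets \<open>K_{3,3}\<close>.
  Gluing needs room beside a vertex whose incident arcs may spiral wildly; they are replaced by
  radii of a small disc, which leaves an empty sector for a straight-line block. A block may go to
  any vertex, even far from the deleted ones: a Theta graph is 2-connected and never spreads over
  two blocks. The block size is the largest possible: \<open>k - 1\<close> vertices just fail to
  carry a Theta graph, and a triangulation on them has \<open>3(k - 1) - 6 = 3k - 9\<close> edges.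
  One or two further vertices are glued as an edge or a triangle. The losses \<open>2k - 3\<close>
  and \<open>k + 1\<close> are then covered exactly from \<open>k = 5\<close> on, while for
  \<open>3k - 6\<close> there is always equality. Graphs on exactly \<open>k\<close> vertices are
  excluded since there \<open>Theta_plus k\<close> forbids nothing, and deleting an unattached
  \<open>S\<close> would leave no vertex to glue at.\<close>

section \<open>\<open>K\<^sub>5\<close> is not planar\<close>

text \<open>Two continuous logarithms of \<open>p t - z\<close> differ by a continuous function with
  values in \<open>2 pi i\<close> times the integers, hence by a constant. So every one of them has
  the increment of the one supplied by \<open>winding_number_as_continuous_log\<close>.\<close>

lemma winding_number_unique_log:
  assumes "path p" "z \<notin> path_image p"
    and q: "continuous_on {0..1} q" "\<And>t. t \<in> {0..1} \<Longrightarrow> p t = z + exp (q t)"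
  shows "q 1 - q 0 = 2 * of_real pi * \<i> * winding_number p z"
proof -
  obtain r where r: "path r" "pathfinish r - pathstart r = 2 * of_real pi * \<i> * winding_number p z"
      "\<And>t. t \<in> {0..1} \<Longrightarrow> p t = z + exp (r t)"
    using winding_number_as_continuous_log assms(1,2) by metis
  define d where "d = (\<lambda>t. (q t - r t) / (2 * of_real pi * \<i>))"
  have "continuous_on {0..1} d"
    unfolding d_def using q(1) r(1) by (auto simp: path_def intro!: continuous_intros)
  moreover have ints: "d t \<in> \<int>" if "t \<in> {0..1}" for t
  proof -
    have "exp (q t - r t) = 1"
      using q(2)[OF that] r(3)[OF that] by (simp add: exp_diff)
    then obtain n :: int where "Re (q t - r t) = 0" "Im (q t - r t) = of_int (2 * n) * pi"
      using exp_eq_1 by metis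
    then have "q t - r t = 2 * of_real pi * \<i> * of_int n"
      by (simp add: complex_eq_iff)
    then show ?thesis by (simp add: d_def)
  qed
  \<comment> \<open>Distinct integers are at distance at least 1; this discreteness makes
    \<open>d\<close> constant.\<close>
  moreover have "1 \<le> norm (d y - d x)" if xy: "x \<in> {0..1}" "y \<in> {0..1}" "d y \<noteq> d x" for x y
  proof -
    have "d y - d x \<in> \<int>"
      using ints xy by auto
    then obtain n :: int where "d y - d x = of_int n"
      by (auto elim: Ints_cases)
    moreover have "n \<noteq> 0"
      using xy(3) calculation by auto
    then have "1 \<le> \<bar>n\<bar>"
      by linarith
    then have "1 \<le> \<bar>real_of_int n\<bar>"
      by linarith
    ultimately show ?thesis
      by (simp add: norm_of_int)
  qed
  ultimately have "d constant_on {0..1}"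
    by (intro continuous_discrete_range_constant[OF connected_Icc])
      (auto intro!: exI[of _ "1::real"])
  then have "d 0 = d 1"
    unfolding constant_on_def by force
  then show ?thesis
    using r(2) by (simp add: d_def pathstart_def pathfinish_def algebra_simps)
qed

text \<open>A logarithm \<open>L\<close> of \<open>g s - h t\<close> exists on the whole square, and
  its increments around the boundary cancel. Up to the factor \<open>2 pi i\<close>, a side with
  \<open>t\<close> fixed contributes the winding number of \<open>g\<close> about
  \<open>h t\<close>, and one with \<open>s\<close> fixed that of \<open>h\<close> about
  \<open>g s\<close>.\<close>

lemma winding_number_square:
  assumes "path g" "path h" "path_image g \<inter> path_image h = {}"
  shows "winding_number g (pathstart h) + winding_number h (pathfinish g) =
         winding_number h (pathstart g) + winding_number g (pathfinish h)"
proof -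
  define Q where "Q = {0..1::real} \<times> {0..1::real}"
  have cont: "continuous_on Q (\<lambda>x. g (fst x) - h (snd x))"
    using assms(1,2) unfolding Q_def path_def
    by (intro continuous_on_diff continuous_on_compose2[of "{0..1}" g, OF _ continuous_on_fst]
        continuous_on_compose2[of "{0..1}" h, OF _ continuous_on_snd]) auto
  have nz: "g (fst x) - h (snd x) \<noteq> 0" if "x \<in> Q" for x
    using assms(3) that unfolding Q_def path_image_def by force
  have "contractible Q"
    unfolding Q_def by (intro convex_imp_contractible convex_Times) auto
  then obtain L where L: "continuous_on Q L" "\<And>x. x \<in> Q \<Longrightarrow> g (fst x) - h (snd x) = exp (L x)"
    using continuous_logarithm_on_contractible[OF cont _ nz] by metis
  have c1: "continuous_on {0..1} (\<lambda>s. L (s, t))" if "t \<in> {0..1}" for t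
    using that by (intro continuous_on_compose2[OF L(1)] continuous_on_Pair) (auto simp: Q_def)
  \<comment> \<open>Adding \<open>i pi\<close> turns a logarithm of \<open>g s - h t\<close> into
    one of \<open>h t - g s\<close>, as needed for the winding number of \<open>h\<close> about
    \<open>g s\<close>.\<close>
  have c2: "continuous_on {0..1} (\<lambda>t. L (s, t) + \<i> * of_real pi)" if "s \<in> {0..1}" for s
    using that by (intro continuous_on_add continuous_on_compose2[OF L(1)] continuous_on_Pair) (auto simp: Q_def)
  have w1: "L (1, t) - L (0, t) = 2 * of_real pi * \<i> * winding_number g (h t)" if t: "t \<in> {0..1}" for t
  proof (rule winding_number_unique_log[OF assms(1) _ c1[OF t]])
    show "h t \<notin> path_image g"
      using assms(3) t unfolding path_image_def by (metis disjoint_iff image_eqI)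
    show "g s = h t + exp (L (s, t))" if "s \<in> {0..1}" for s
      using L(2)[of "(s, t)"] t that by (simp add: Q_def algebra_simps)
  qed
  have w2: "(L (s, 1) + \<i> * of_real pi) - (L (s, 0) + \<i> * of_real pi) = 2 * of_real pi * \<i> * winding_number h (g s)" if s: "s \<in> {0..1}" for s
  proof (rule winding_number_unique_log[OF assms(2) _ c2[OF s]])
    show "g s \<notin> path_image h"
      using assms(3) s unfolding path_image_def by (metis disjoint_iff image_eqI)
    show "h t = g s + exp (L (s, t) + \<i> * of_real pi)" if "t \<in> {0..1}" for t
      using L(2)[of "(s, t)"] s that by (simp add: Q_def algebra_simps exp_add)
  qed
  have "2 * of_real pi * \<i> * (winding_number g (h 0) + winding_number h (g 1)) =
        2 * of_real pi * \<i> * (winding_number h (g 0) + winding_number g (h 1))"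
    using w1[of 0] w1[of 1] w2[of 0] w2[of 1] by (simp add: algebra_simps)
  then show ?thesis
    by (simp add: pathstart_def pathfinish_def)
qed

text \<open>Van Kampen's obstruction: correcting the winding number of an edge about a vertex by fixed
  arguments of the differences of vertices gives an integer. By \<open>winding_number_square\<close>, the four
  integers belonging to a pair of disjoint edges have an odd sum iff the edges cross in convex
  position; there are five such pairs, but every integer occurs in two of the 15 sums.\<close>

lemma no_planar_K5:
  fixes p :: "nat \<Rightarrow> complex" and g :: "nat \<Rightarrow> nat \<Rightarrow> real \<Rightarrow> complex"
  assumes g: "\<And>i j. i < j \<Longrightarrow> j < 5 \<Longrightarrow> path (g i j) \<and> pathstart (g i j) = p i \<and> pathfinish (g i j) = p j"
    and disj: "\<And>i j k l. i < j \<Longrightarrow> j < 5 \<Longrightarrow> k < l \<Longrightarrow> l < 5 \<Longrightarrow> {i, j} \<inter> {k, l} = {} \<Longrightarrow>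
       path_image (g i j) \<inter> path_image (g k l) = {}"
  shows False
proof -
  define c where "c = 2 * of_real pi * \<i>"
  have c0: "c \<noteq> 0" by (simp add: c_def)
  \<comment> \<open>\<open>p k\<close> is an end of the curve joining it to a fourth vertex
    \<open>l\<close>, and that curve is disjoint from the one of \<open>{i, j}\<close>.\<close>
  have off: "p k \<notin> path_image (g i j)" if "i < j" "j < 5" "k < 5" "k \<noteq> i" "k \<noteq> j" for i j k
  proof -
    obtain l where l: "l < 5" "l \<noteq> i" "l \<noteq> j" "l \<noteq> k"
    proof -
      have "card ({..<5::nat} - {i, j, k}) \<ge> 5 - card {i, j, k}"
        using diff_card_le_card_Diff[of "{i,j,k}" "{..<5}"] by simp
      moreover have "card {i, j, k} \<le> 3" by (simp add: card_insert_if)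
      ultimately have "card ({..<5::nat} - {i, j, k}) > 0" by linarith
      then have "{..<5::nat} - {i, j, k} \<noteq> {}" by (metis card.empty less_irrefl)
      then show ?thesis using that by blast
    qed
    show ?thesis
    proof (cases "k < l")
      case True
      then have "p k \<in> path_image (g k l)" using g[of k l] l by (metis pathstart_in_path_image)
      then show ?thesis using disj[of i j k l] that l True by auto
    next
      case False
      then have "p k \<in> path_image (g l k)" using g[of l k] l that by (metis pathfinish_in_path_image linorder_neqE_nat)
      then show ?thesis using disj[of i j l k] that l False by auto
    qed
  qed
  have neq: "p i \<noteq> p j" if ij: "i < j" "j < 5" for i j
  proof -
    obtain k where k: "k < 5" "k \<noteq> i" "k \<noteq> j"
    proof -
      have "card ({..<5::nat} - {i, j}) \<ge> 5 - card {i, j}"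
        using diff_card_le_card_Diff[of "{i,j}" "{..<5}"] by simp
      moreover have "card {i, j} \<le> 2" by (simp add: card_insert_if)
      ultimately have "card ({..<5::nat} - {i, j}) > 0" by linarith
      then have "{..<5::nat} - {i, j} \<noteq> {}" by (metis card.empty less_irrefl)
      then show ?thesis using that by blast
    qed
    show ?thesis
    proof (cases "k < j")
      case True
      then show ?thesis using off[of k j i] g[of k j] k ij
        by (metis less_trans not_less_iff_gr_or_eq pathfinish_in_path_image)
    next
      case False
      then show ?thesis using off[of j k i] g[of j k] k ij
        by (metis less_trans not_less_iff_gr_or_eq pathstart_in_path_image)
    qed
  qed
  \<comment> \<open>\<open>f i j\<close> is a logarithm of \<open>p j - p i\<close>. For
    \<open>i > j\<close> it is derived from the opposite one, so that \<open>f j i\<close> and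
    \<open>f i j\<close> differ by exactly half a period \<open>c / 2\<close>, with a sign known
    from the order of \<open>i\<close> and \<open>j\<close>.\<close>
  define f where "f i j = (if i < j then Ln (p j - p i) else Ln (p i - p j) + c / 2)" for i j
  have f: "exp (f i j) = p j - p i" if "i < 5" "j < 5" "i \<noteq> j" for i j
    using neq[of i j] neq[of j i] that by (auto simp: f_def c_def exp_add mult.commute[of _ "\<i>"])
  \<comment> \<open>Both terms measure the turn from \<open>p i\<close> to \<open>p j\<close> as
    seen from \<open>p k\<close>, so their difference is an integer.\<close>
  define n where "n k i j = winding_number (g i j) (p k) - (f k j - f k i) / c" for k i j
  have "n k i j \<in> \<int>" if "i < j" "j < 5" "k < 5" "k \<noteq> i" "k \<noteq> j" for i j k
  proof -
    have "p j - p k = exp (c * winding_number (g i j) (p k)) * (p i - p k)"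
      using winding_number_exp_2pi[of "g i j" "p k"] off[OF that] g[of i j] that by (simp add: c_def mult.commute mult.left_commute)
    then have "exp (f k j) = exp (c * winding_number (g i j) (p k)) * exp (f k i)"
      using f[of k j] f[of k i] that by simp
    moreover have "c * n k i j = c * winding_number (g i j) (p k) - (f k j - f k i)"
      using c0 by (simp add: n_def field_simps)
    ultimately have "exp (c * n k i j) = 1"
      by (simp add: exp_diff)
    then obtain N :: int where "Re (c * n k i j) = 0" "Im (c * n k i j) = of_int (2 * N) * pi"
      using exp_eq_1 by metis
    then have "c * n k i j = c * of_int N"
      by (simp add: c_def complex_eq_iff)
    then show ?thesis using c0 by simp
  qed
  then have n: "n k i j \<in> \<int>" if "i < j" "j < 5" "k < 5" "k \<noteq> i" "k \<noteq> j" for i j k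
    using that by blast
  define m where "m k i j = \<lfloor>Re (n k i j)\<rfloor>" for k i j
  have m: "n k i j = of_int (m k i j)" if "i < j" "j < 5" "k < 5" "k \<noteq> i" "k \<noteq> j" for i j k
    using n[OF that] by (auto simp: m_def elim!: Ints_cases)
  define s :: "nat \<Rightarrow> nat \<Rightarrow> complex" where "s i j = (if i < j then 1/2 else -1/2)" for i j
  have s: "f j i = f i j + c * s i j" if "i \<noteq> j" for i j
    using that by (auto simp: f_def s_def)
  \<comment> \<open>In \<open>winding_number_square\<close> the eight logarithms cancel in pairs
    \<open>f x y\<close>, \<open>f y x\<close>, each pair leaving a half.\<close>
  have rel: "of_int (m k i j + m j k l - m i k l - m l i j) = - (s j k + s k i + s l j + s i l)"
    if "i < j" "j < 5" "k < l" "l < 5" "{i, j} \<inter> {k, l} = {}" for i j k l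
  proof -
    have "winding_number (g i j) (p k) + winding_number (g k l) (p j) =
          winding_number (g k l) (p i) + winding_number (g i j) (p l)"
      using winding_number_square[of "g i j" "g k l"] g[of i j] g[of k l] disj[of i j k l] that by simp
    then have "n k i j + (f k j - f k i) / c + (n j k l + (f j l - f j k) / c) =
          n i k l + (f i l - f i k) / c + (n l i j + (f l j - f l i) / c)"
      by (simp add: n_def)
    moreover have "f k j / c = f j k / c + s j k" "f i k / c = f k i / c + s k i"
      "f j l / c = f l j / c + s l j" "f l i / c = f i l / c + s i l"
      using that s[of j k] s[of k i] s[of l j] s[of i l] c0 by (simp_all add: add_divide_distrib)
    ultimately have "n k i j + n j k l - n i k l - n l i j = - (s j k + s k i + s l j + s i l)"
      by (simp add: diff_divide_distrib algebra_simps)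
    then show ?thesis using m[of i j k] m[of k l j] m[of k l i] m[of i j l] that by simp
  qed
  have rel': "m k i j + m j k l - m i k l - m l i j = (if k < j then 1 else 0) + (if i < k then 1 else 0)
       + (if j < l then 1 else 0) + (if l < i then 1 else 0) - 2"
    if "i < j" "j < 5" "k < l" "l < 5" "{i, j} \<inter> {k, l} = {}" for i j k l
  proof -
    have "(of_int (m k i j + m j k l - m i k l - m l i j) :: complex) =
      of_int ((if k < j then 1 else 0) + (if i < k then 1 else 0)
       + (if j < l then 1 else 0) + (if l < i then 1 else 0) - 2)"
      unfolding rel[OF that] s_def using that
      by (cases "k < j"; cases "i < k"; cases "j < l"; cases "l < i") simp_all
    then show ?thesis by (simp only: of_int_eq_iff)
  qed
  \<comment> \<open>The 15 pairs of disjoint edges; the right-hand side is 1 for the five pairs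
    whose ends interleave, \<open>i < k < j < l\<close>.\<close>
  have e0: "m 2 0 1 + m 1 2 3 - m 0 2 3 - m 3 0 1 = 0"
    using rel'[of 0 1 2 3] by simp
  have e1: "m 2 0 1 + m 1 2 4 - m 0 2 4 - m 4 0 1 = 0"
    using rel'[of 0 1 2 4] by simp
  have e2: "m 3 0 1 + m 1 3 4 - m 0 3 4 - m 4 0 1 = 0"
    using rel'[of 0 1 3 4] by simp
  have e3: "m 1 0 2 + m 2 1 3 - m 0 1 3 - m 3 0 2 = 1"
    using rel'[of 0 2 1 3] by simp
  have e4: "m 1 0 2 + m 2 1 4 - m 0 1 4 - m 4 0 2 = 1"
    using rel'[of 0 2 1 4] by simp
  have e5: "m 3 0 2 + m 2 3 4 - m 0 3 4 - m 4 0 2 = 0"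
    using rel'[of 0 2 3 4] by simp
  have e6: "m 1 0 3 + m 3 1 2 - m 0 1 2 - m 2 0 3 = 0"
    using rel'[of 0 3 1 2] by simp
  have e7: "m 1 0 3 + m 3 1 4 - m 0 1 4 - m 4 0 3 = 1"
    using rel'[of 0 3 1 4] by simp
  have e8: "m 2 0 3 + m 3 2 4 - m 0 2 4 - m 4 0 3 = 1"
    using rel'[of 0 3 2 4] by simp
  have e9: "m 1 0 4 + m 4 1 2 - m 0 1 2 - m 2 0 4 = 0"
    using rel'[of 0 4 1 2] by simp
  have e10: "m 1 0 4 + m 4 1 3 - m 0 1 3 - m 3 0 4 = 0"
    using rel'[of 0 4 1 3] by simp
  have e11: "m 2 0 4 + m 4 2 3 - m 0 2 3 - m 3 0 4 = 0"
    using rel'[of 0 4 2 3] by simp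
  have e12: "m 3 1 2 + m 2 3 4 - m 1 3 4 - m 4 1 2 = 0"
    using rel'[of 1 2 3 4] by simp
  have e13: "m 2 1 3 + m 3 2 4 - m 1 2 4 - m 4 1 3 = 1"
    using rel'[of 1 3 2 4] by simp
  have e14: "m 2 1 4 + m 4 2 3 - m 1 2 3 - m 3 1 4 = 0"
    using rel'[of 1 4 2 3] by simp
  \<comment> \<open>Of the 30 integers, \<open>X\<close> collects the 20 that have the same sign in
    both of their equations; the other ten cancel in the sum. So the sum is even, but it is
    5.\<close>
  define X where "X = m 2 0 1 + m 1 0 2 + m 2 1 3 + m 2 1 4 + m 2 3 4 + m 1 0 3 + m 3 1 2 + m 3 2 4 + m 1 0 4 + m 4 2 3 - m 0 2 3 - m 0 2 4 - m 4 0 1 - m 0 3 4 - m 0 1 3 - m 0 1 4 - m 4 0 2 - m 0 1 2 - m 4 0 3 - m 3 0 4"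
  have "2 * X =
      (m 2 0 1 + m 1 2 3 - m 0 2 3 - m 3 0 1) +
      (m 2 0 1 + m 1 2 4 - m 0 2 4 - m 4 0 1) +
      (m 3 0 1 + m 1 3 4 - m 0 3 4 - m 4 0 1) +
      (m 1 0 2 + m 2 1 3 - m 0 1 3 - m 3 0 2) +
      (m 1 0 2 + m 2 1 4 - m 0 1 4 - m 4 0 2) +
      (m 3 0 2 + m 2 3 4 - m 0 3 4 - m 4 0 2) +
      (m 1 0 3 + m 3 1 2 - m 0 1 2 - m 2 0 3) +
      (m 1 0 3 + m 3 1 4 - m 0 1 4 - m 4 0 3) +
      (m 2 0 3 + m 3 2 4 - m 0 2 4 - m 4 0 3) +
      (m 1 0 4 + m 4 1 2 - m 0 1 2 - m 2 0 4) +
      (m 1 0 4 + m 4 1 3 - m 0 1 3 - m 3 0 4) +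
      (m 2 0 4 + m 4 2 3 - m 0 2 3 - m 3 0 4) +
      (m 3 1 2 + m 2 3 4 - m 1 3 4 - m 4 1 2) +
      (m 2 1 3 + m 3 2 4 - m 1 2 4 - m 4 1 3) +
      (m 2 1 4 + m 4 2 3 - m 1 2 3 - m 3 1 4)"
    unfolding X_def by (simp add: algebra_simps)
  also have "\<dots> = 5"
    unfolding e0 e1 e2 e3 e4 e5 e6 e7 e8 e9 e10 e11 e12 e13 e14 by simp
  finally show False by presburger
qed

section \<open>Minors of drawings and the planar edge bound\<close>

definition drawing :: "'a graph \<Rightarrow> ('a \<Rightarrow> complex) \<Rightarrow> ('a set \<Rightarrow> real \<Rightarrow> complex) \<Rightarrow> bool" where
  "drawing G p \<gamma> \<longleftrightarrow>
     inj_on p (verts G) \<and>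
     (\<forall>e\<in>edges G. arc (\<gamma> e) \<and>
        {pathstart (\<gamma> e), pathfinish (\<gamma> e)} = p ` e \<and>
        path_image (\<gamma> e) \<inter> p ` verts G = p ` e) \<and>
     (\<forall>e\<in>edges G. \<forall>e'\<in>edges G. e \<noteq> e' \<longrightarrow>
        path_image (\<gamma> e) \<inter> path_image (\<gamma> e') \<subseteq> p ` verts G)"

lemma planar_iff_drawing: "planar G \<longleftrightarrow> (\<exists>p \<gamma>. drawing G p \<gamma>)"
  by (simp add: planar_def drawing_def)

lemma drawingD:
  assumes "drawing G p \<gamma>"
  shows "inj_on p (verts G)"
    and "e \<in> edges G \<Longrightarrow> arc (\<gamma> e)"
    and "e \<in> edges G \<Longrightarrow> {pathstart (\<gamma> e), pathfinish (\<gamma> e)} = p ` e"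
    and "e \<in> edges G \<Longrightarrow> x \<in> path_image (\<gamma> e) \<Longrightarrow> x \<in> p ` verts G \<Longrightarrow> x \<in> p ` e"
    and "e \<in> edges G \<Longrightarrow> p ` e \<subseteq> path_image (\<gamma> e)"
    and "e \<in> edges G \<Longrightarrow> e' \<in> edges G \<Longrightarrow> e \<noteq> e' \<Longrightarrow> x \<in> path_image (\<gamma> e) \<Longrightarrow>
      x \<in> path_image (\<gamma> e') \<Longrightarrow> x \<in> p ` verts G"
proof -
  note d = assms[unfolded drawing_def]
  show "inj_on p (verts G)"
    using d by blast
  show "arc (\<gamma> e)" "{pathstart (\<gamma> e), pathfinish (\<gamma> e)} = p ` e" if "e \<in> edges G"
    using d that by blast+
  have *: "path_image (\<gamma> e) \<inter> p ` verts G = p ` e" if "e \<in> edges G"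
    using d that by blast
  show "p ` e \<subseteq> path_image (\<gamma> e)" if "e \<in> edges G"
    using *[OF that] by (metis Int_lower1)
  show "x \<in> p ` e" if "e \<in> edges G" "x \<in> path_image (\<gamma> e)" "x \<in> p ` verts G"
    using *[OF that(1)] that(2,3) by (metis IntI)
  have "path_image (\<gamma> e) \<inter> path_image (\<gamma> e') \<subseteq> p ` verts G"
    if "e \<in> edges G" "e' \<in> edges G" "e \<noteq> e'"
    using d that by blast
  then show "e \<in> edges G \<Longrightarrow> e' \<in> edges G \<Longrightarrow> e \<noteq> e' \<Longrightarrow> x \<in> path_image (\<gamma> e) \<Longrightarrow>
      x \<in> path_image (\<gamma> e') \<Longrightarrow> x \<in> p ` verts G"
    by blast
qed

lemma planar_mono:
  assumes "planar G" "verts H \<subseteq> verts G" "edges H \<subseteq> edges G" "\<And>e. e \<in> edges H \<Longrightarrow> e \<subseteq> verts H"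
  shows "planar H"
proof -
  obtain p \<gamma> where d: "drawing G p \<gamma>"
    using assms(1) planar_iff_drawing by blast
  note dG = drawingD[OF d]
  have "drawing H p \<gamma>"
    unfolding drawing_def
  proof (intro conjI ballI impI)
    show "inj_on p (verts H)"
      using dG(1) assms(2) inj_on_subset by blast
    fix e assume e: "e \<in> edges H"
    then have eG: "e \<in> edges G"
      using assms(3) by blast
    show "arc (\<gamma> e)" "{pathstart (\<gamma> e), pathfinish (\<gamma> e)} = p ` e"
      using dG(2,3)[OF eG] by auto
    have sub: "p ` e \<subseteq> p ` verts H" "p ` verts H \<subseteq> p ` verts G"
      using assms(2) assms(4)[OF e] by auto
    show "path_image (\<gamma> e) \<inter> p ` verts H = p ` e"
      using dG(4)[OF eG] dG(5)[OF eG] sub by auto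
    fix e' assume e': "e' \<in> edges H" "e \<noteq> e'"
    then have e'G: "e' \<in> edges G"
      using assms(3) by blast
    \<comment> \<open>A common point is a vertex of \<open>G\<close> on the arc of \<open>e\<close>,
      hence an end of \<open>e\<close>, and the ends of \<open>e\<close> survive in
      \<open>H\<close>.\<close>
    show "path_image (\<gamma> e) \<inter> path_image (\<gamma> e') \<subseteq> p ` verts H"
    proof
      fix x assume "x \<in> path_image (\<gamma> e) \<inter> path_image (\<gamma> e')"
      then have "x \<in> p ` e"
        using dG(4)[OF eG] dG(6)[OF eG e'G e'(2)] by blast
      then show "x \<in> p ` verts H"
        using sub(1) by blast
    qed
  qed
  then show ?thesis
    using planar_iff_drawing by blast
qed

section \<open>Minors given by branch sets\<close>

definition connected_in :: "'a graph \<Rightarrow> 'a set \<Rightarrow> bool" where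
  "connected_in G A \<longleftrightarrow> (\<forall>x\<in>A. \<forall>y\<in>A. (x, y) \<in> {(a, b). a \<in> A \<and> b \<in> A \<and> {a, b} \<in> edges G}\<^sup>*)"

definition touching :: "'a graph \<Rightarrow> 'a set \<Rightarrow> 'a set \<Rightarrow> bool" where
  "touching G A B \<longleftrightarrow> (\<exists>a\<in>A. \<exists>b\<in>B. {a, b} \<in> edges G)"

lemma touching_sym: "touching G A B \<Longrightarrow> touching G B A"
  unfolding touching_def by (metis insert_commute)

lemma connected_in_singleton: "connected_in G {x}"
  by (simp add: connected_in_def)

lemma connected_in_Un:
  assumes "connected_in G A" "connected_in G B" "touching G A B"
  shows "connected_in G (A \<union> B)"
proof -
  define R where "R C = {(a, b). a \<in> C \<and> b \<in> C \<and> {a, b} \<in> edges G}" for C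
  have sub: "(R A)\<^sup>* \<subseteq> (R (A \<union> B))\<^sup>*" "(R B)\<^sup>* \<subseteq> (R (A \<union> B))\<^sup>*"
    by (intro rtrancl_mono; auto simp: R_def)+
  obtain a b where ab: "a \<in> A" "b \<in> B" "{a, b} \<in> edges G"
    using assms(3) by (auto simp: touching_def)
  then have step: "(a, b) \<in> (R (A \<union> B))\<^sup>*" "(b, a) \<in> (R (A \<union> B))\<^sup>*"
    by (auto simp: R_def insert_commute)
  have A: "(x, y) \<in> (R (A \<union> B))\<^sup>*" if "x \<in> A" "y \<in> A" for x y
    using assms(1) that sub(1) unfolding connected_in_def R_def by blast
  have B: "(x, y) \<in> (R (A \<union> B))\<^sup>*" if "x \<in> B" "y \<in> B" for x y
    using assms(2) that sub(2) unfolding connected_in_def R_def by blast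
  have "(x, y) \<in> (R (A \<union> B))\<^sup>*" if xy: "x \<in> A \<union> B" "y \<in> A \<union> B" for x y
  proof -
    consider "x \<in> A" "y \<in> A" | "x \<in> B" "y \<in> B" | "x \<in> A" "y \<in> B" | "x \<in> B" "y \<in> A"
      using xy by blast
    then show ?thesis
    proof cases
      case 3
      then show ?thesis
        using A[OF 3(1) ab(1)] step(1) B[OF ab(2) 3(2)] by (meson rtrancl_trans)
    next
      case 4
      then show ?thesis
        using B[OF 4(1) ab(2)] step(2) A[OF ab(1) 4(2)] by (meson rtrancl_trans)
    qed (use A B in blast)+
  qed
  then show ?thesis
    by (simp add: connected_in_def R_def)
qed

text \<open>Only a path is claimed, not a simple arc: concatenating arcs along a walk in
  \<open>A\<close> suffices, because \<open>no_planar_K5\<close> tolerates curves that cross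
  themselves.\<close>

lemma connected_in_drawing:
  assumes d: "drawing G p \<gamma>" and c: "connected_in G A" and "x \<in> A" "y \<in> A"
  obtains g where "path g" "pathstart g = p x" "pathfinish g = p y"
    "path_image g \<subseteq> p ` A \<union> (\<Union>e\<in>{e \<in> edges G. e \<subseteq> A}. path_image (\<gamma> e))"
proof -
  define D where "D = p ` A \<union> (\<Union>e\<in>{e \<in> edges G. e \<subseteq> A}. path_image (\<gamma> e))"
  have "(x, y) \<in> {(a, b). a \<in> A \<and> b \<in> A \<and> {a, b} \<in> edges G}\<^sup>*"
    using c assms(3,4) by (simp add: connected_in_def)
  then have "path_component D (p x) (p y)"
  proof (induction rule: rtrancl_induct)
    case base
    then show ?case
      using assms(3) by (auto simp: D_def path_component_refl)
  next
    case (step b c)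
    then have e: "{b, c} \<in> edges G" "{b, c} \<subseteq> A"
      by auto
    then have arc: "arc (\<gamma> {b, c})" and ends: "{pathstart (\<gamma> {b, c}), pathfinish (\<gamma> {b, c})} = {p b, p c}"
      using drawingD(2,3)[OF d e(1)] by auto
    have sub: "path_image (\<gamma> {b, c}) \<subseteq> D"
      using e unfolding D_def by blast
    have pc: "path_component D (pathstart (\<gamma> {b, c})) (pathfinish (\<gamma> {b, c}))"
      using arc sub arc_imp_path unfolding path_component_def by blast
    have "path_component D (p b) (p c)"
      using ends pc path_component_sym by (metis doubleton_eq_iff)
    with step.IH show ?case
      by (rule path_component_trans)
  qed
  then show thesis
    using that unfolding path_component_def D_def by blast
qed

text \<open>A common point of the arcs of two different edges is a vertex, thus an end of both,
  which disjointness of \<open>A\<close> and \<open>B\<close> forbids. An empty edge would be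
  contained in \<open>A\<close> and in \<open>B\<close>; \<open>ne\<close> excludes it.\<close>

lemma drawing_parts_disjoint:
  assumes d: "drawing G p \<gamma>" and "A \<subseteq> verts G" "B \<subseteq> verts G" "A \<inter> B = {}"
    and ne: "\<And>e. e \<in> edges G \<Longrightarrow> e \<noteq> {}"
  shows "(p ` A \<union> (\<Union>e\<in>{e \<in> edges G. e \<subseteq> A}. path_image (\<gamma> e))) \<inter>
         (p ` B \<union> (\<Union>e\<in>{e \<in> edges G. e \<subseteq> B}. path_image (\<gamma> e))) = {}"
proof -
  note v = drawingD(4)[OF d]
  have dis: "p ` A \<inter> p ` B = {}"
    using drawingD(1)[OF d] assms(2-4) by (metis image_empty inj_on_image_Int)
  {
    fix x e f assume *: "e \<in> edges G" "e \<subseteq> A" "x \<in> path_image (\<gamma> e)" "f \<in> edges G" "f \<subseteq> B" "x \<in> path_image (\<gamma> f)"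
    then have "e \<noteq> f"
      using assms(4) ne by blast
    then have "x \<in> p ` verts G"
      using drawingD(6)[OF d *(1,4)] *(3,6) by blast
    then have "x \<in> p ` A" "x \<in> p ` B"
      using v * by blast+
    then have False using dis by blast
  }
  moreover have "x \<in> p ` A \<Longrightarrow> x \<notin> path_image (\<gamma> e)" if "e \<in> edges G" "e \<subseteq> B" for x e
    using v[OF that(1), of x] that(2) assms(2) dis by blast
  moreover have "x \<in> p ` B \<Longrightarrow> x \<notin> path_image (\<gamma> e)" if "e \<in> edges G" "e \<subseteq> A" for x e
    using v[OF that(1), of x] that(2) assms(3) dis by blast
  ultimately show ?thesis
    using dis by blast
qed

text \<open>A model of a minor of \<open>G\<close>: the sets are its vertices, and touching sets may
  be adjacent. Contracting an edge is then taking a union, and no minor ever has to be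
  drawn.\<close>

definition branch_sets :: "'a graph \<Rightarrow> 'a set set \<Rightarrow> bool" where
  "branch_sets G \<B> \<longleftrightarrow> finite \<B> \<and> pairwise disjnt \<B> \<and>
     (\<forall>B\<in>\<B>. B \<noteq> {} \<and> B \<subseteq> verts G \<and> connected_in G B)"

text \<open>Representatives of two branch sets are joined inside the union of these sets. For
  disjoint pairs of indices the unions are disjoint, hence so are the curves; curves that share an
  index may meet anywhere, which \<open>no_planar_K5\<close> permits.\<close>

lemma planar_no_K5_minor:
  assumes "planar G" "simple_graph G" "branch_sets G \<B>" "card \<B> = 5"
    and touch: "pairwise (touching G) \<B>"
  shows False
proof -
  obtain p \<gamma> where d: "drawing G p \<gamma>"
    using assms(1) planar_iff_drawing by blast
  obtain B where B: "bij_betw B {..<5::nat} \<B>"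
    using assms(3,4) ex_bij_betw_nat_finite[of \<B>] by (auto simp: branch_sets_def lessThan_atLeast0)
  have inB: "B i \<in> \<B>" if "i < 5" for i
    using B that by (auto simp: bij_betw_def)
  have neq: "B i \<noteq> B j" if "i < 5" "j < 5" "i \<noteq> j" for i j
    using B that by (auto simp: bij_betw_def inj_on_def)
  have dis: "B i \<inter> B j = {}" if "i < 5" "j < 5" "i \<noteq> j" for i j
    using assms(3) inB[OF that(1)] inB[OF that(2)] neq[OF that]
    by (auto simp: branch_sets_def pairwise_def disjnt_def)
  have sub: "B i \<subseteq> verts G" if "i < 5" for i
    using assms(3) inB[OF that] by (auto simp: branch_sets_def)
  have "\<forall>i. \<exists>b. i < 5 \<longrightarrow> b \<in> B i"
    using assms(3) inB unfolding branch_sets_def by blast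
  then obtain b where b: "\<And>i. i < 5 \<Longrightarrow> b i \<in> B i"
    by metis
  define D where "D A = p ` A \<union> (\<Union>e\<in>{e \<in> edges G. e \<subseteq> A}. path_image (\<gamma> e))" for A
  have "\<exists>g. i < j \<and> j < 5 \<longrightarrow> path g \<and> pathstart g = p (b i) \<and> pathfinish g = p (b j) \<and> path_image g \<subseteq> D (B i \<union> B j)" for i j
  proof (cases "i < j \<and> j < 5")
    case True
    then have "connected_in G (B i)" "connected_in G (B j)" "touching G (B i) (B j)"
      using assms(3) inB[of i] inB[of j] neq[of i j] touch by (auto simp: branch_sets_def pairwise_def)
    then have "connected_in G (B i \<union> B j)"
      by (rule connected_in_Un)
    moreover have "b i \<in> B i \<union> B j" "b j \<in> B i \<union> B j"
      using b True by auto
    ultimately obtain g where "path g" "pathstart g = p (b i)" "pathfinish g = p (b j)"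
        "path_image g \<subseteq> D (B i \<union> B j)"
      using connected_in_drawing[OF d] unfolding D_def by blast
    then show ?thesis by blast
  qed auto
  then obtain g where g: "\<And>i j. i < j \<Longrightarrow> j < 5 \<Longrightarrow>
      path (g i j) \<and> pathstart (g i j) = p (b i) \<and> pathfinish (g i j) = p (b j) \<and> path_image (g i j) \<subseteq> D (B i \<union> B j)"
    by metis
  have ne: "e \<noteq> {}" if "e \<in> edges G" for e
    using assms(2) that unfolding simple_graph_def by force
  show False
  proof (rule no_planar_K5[of g "\<lambda>i. p (b i)"])
    show "path (g i j) \<and> pathstart (g i j) = p (b i) \<and> pathfinish (g i j) = p (b j)" if "i < j" "j < 5" for i j
      using g that by blast
    fix i j k l :: nat assume *: "i < j" "j < 5" "k < l" "l < 5" "{i, j} \<inter> {k, l} = {}"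
    then have "(B i \<union> B j) \<inter> (B k \<union> B l) = {}"
      using dis[of i k] dis[of i l] dis[of j k] dis[of j l] by auto
    moreover have "B i \<union> B j \<subseteq> verts G" "B k \<union> B l \<subseteq> verts G"
      using sub * by auto
    ultimately have "D (B i \<union> B j) \<inter> D (B k \<union> B l) = {}"
      using drawing_parts_disjoint[OF d _ _ _ ne] unfolding D_def by blast
    then show "path_image (g i j) \<inter> path_image (g k l) = {}"
      using g[OF *(1,2)] g[OF *(3,4)] by blast
  qed
qed

section \<open>The edge bound by contraction\<close>

text \<open>Contracting \<open>{a, b}\<close> to \<open>m\<close> loses this edge and identifies
  \<open>{a, x}\<close> with \<open>{b, x}\<close> for every common neighbour \<open>x\<close>, and
  nothing else. The 3 is one edge plus two common neighbours.\<close>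

lemma card_contract_edges:
  fixes \<E> :: "'b set set"
  assumes fin: "finite \<E>" and two: "\<And>e. e \<in> \<E> \<Longrightarrow> card e = 2"
    and m: "m \<notin> \<Union>\<E>"
    and C: "finite {x. {a, x} \<in> \<E> \<and> {b, x} \<in> \<E>}" "card {x. {a, x} \<in> \<E> \<and> {b, x} \<in> \<E>} \<le> 2"
  shows "card \<E> \<le> card ((`) (\<lambda>x. if x = a \<or> x = b then m else x) ` (\<E> - {{a, b}})) + 3"
proof -
  define \<phi> where "\<phi> x = (if x = a \<or> x = b then m else x)" for x
  define C where "C = {x. {a, x} \<in> \<E> \<and> {b, x} \<in> \<E>}"
  \<comment> \<open>Besides \<open>{a, b}\<close>, one edge of each pair that gets identified is
    left out; on the rest the contraction is injective.\<close>
  define F where "F = \<E> - insert {a, b} ((\<lambda>x. {b, x}) ` C)"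
  have pair: "\<exists>x y. e = {x, y} \<and> x \<noteq> y \<and> x \<noteq> m \<and> y \<noteq> m" if e: "e \<in> \<E>" for e
  proof -
    obtain x y where "e = {x, y}" "x \<noteq> y"
      using two[OF e] by (auto simp: card_2_iff)
    moreover have "x \<noteq> m" "y \<noteq> m"
      using m e calculation by blast+
    ultimately show ?thesis by blast
  qed
  have "inj_on ((`) \<phi>) F"
  proof (rule inj_onI)
    fix e f assume e: "e \<in> F" and f: "f \<in> F" and eq: "\<phi> ` e = \<phi> ` f"
    have eE: "e \<in> \<E>" "f \<in> \<E>" "e \<noteq> {a, b}" "f \<noteq> {a, b}"
      using e f by (auto simp: F_def)
    obtain x y where xy: "e = {x, y}" "x \<noteq> y" "x \<noteq> m" "y \<noteq> m"
      using pair eE(1) by blast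
    obtain u v where uv: "f = {u, v}" "u \<noteq> v" "u \<noteq> m" "v \<noteq> m"
      using pair eE(2) by blast
    have nC: "{b, z} \<notin> F" if "{a, z} \<in> \<E>" for z
      using that by (auto simp: F_def C_def)
    have FE: "{a, z} \<in> F \<Longrightarrow> {a, z} \<in> \<E>" for z
      by (simp add: F_def)
    have key: "z = w" if "z = a \<or> z = b" "w = a \<or> w = b" "{z, y} \<in> F" "{w, y} \<in> F" for z w y
      using nC[of y] FE[of y] that by auto
    have same: "z = w \<or> (z = a \<or> z = b) \<and> (w = a \<or> w = b)" if "\<phi> z = \<phi> w" "z \<noteq> m" "w \<noteq> m" for z w
      using that by (auto simp: \<phi>_def split: if_splits)
    have L: "{x, y} = {u, v}" if F: "{x, y} \<in> F" "{u, v} \<in> F" and ne: "x \<noteq> y" "u \<noteq> v" "{x, y} \<noteq> {a, b}" "{u, v} \<noteq> {a, b}"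
      and m: "x \<noteq> m" "y \<noteq> m" "u \<noteq> m" "v \<noteq> m" and "\<phi> x = \<phi> u" "\<phi> y = \<phi> v" for x y u v
    proof -
      have nb: "\<not> ((x = a \<or> x = b) \<and> (y = a \<or> y = b))" "\<not> ((u = a \<or> u = b) \<and> (v = a \<or> v = b))"
        using ne by auto
      have "x = u \<or> (x = a \<or> x = b) \<and> (u = a \<or> u = b)" "y = v \<or> (y = a \<or> y = b) \<and> (v = a \<or> v = b)"
        using same that by blast+
      then consider "x = u" "y = v" | "y = v" "x = a \<or> x = b" "u = a \<or> u = b" | "x = u" "y = a \<or> y = b" "v = a \<or> v = b"
        using nb by blast
      then show ?thesis
      proof cases
        case 2
        then show ?thesis using key[of x u y] F by simp
      next
        case 3
        then show ?thesis using key[of y v x] F by (simp add: insert_commute)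
      qed simp
    qed
    have "{\<phi> x, \<phi> y} = {\<phi> u, \<phi> v}"
      using eq by (simp add: xy uv)
    then have "\<phi> x = \<phi> u \<and> \<phi> y = \<phi> v \<or> \<phi> x = \<phi> v \<and> \<phi> y = \<phi> u"
      by (simp add: doubleton_eq_iff)
    then show "e = f"
      using L[of x y u v] L[of x y v u] xy uv e f eE(3,4) by (auto simp: insert_commute)
  qed
  then have "card F = card ((`) \<phi> ` F)"
    by (simp add: card_image)
  also have "\<dots> \<le> card ((`) \<phi> ` (\<E> - {{a, b}}))"
    using fin by (intro card_mono) (auto simp: F_def)
  finally have "card F \<le> card ((`) \<phi> ` (\<E> - {{a, b}}))" .
  moreover have "card \<E> \<le> card F + card (insert {a, b} ((\<lambda>x. {b, x}) ` C))"
    using diff_card_le_card_Diff[of "insert {a, b} ((\<lambda>x. {b, x}) ` C)" \<E>] C(1)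
    unfolding F_def C_def by simp
  moreover have "card (insert {a, b} ((\<lambda>x. {b, x}) ` C)) \<le> 3"
  proof -
    have "card ((\<lambda>x. {b, x}) ` C) \<le> 2"
      using card_image_le[of C "\<lambda>x. {b, x}"] C unfolding C_def by linarith
    then show ?thesis
      by (simp add: card_insert_if C C_def)
  qed
  ultimately show ?thesis
    unfolding \<phi>_def by linarith
qed

lemma exists_low_degree:
  assumes "finite \<B>" "finite \<E>" "\<And>e. e \<in> \<E> \<Longrightarrow> e \<subseteq> \<B> \<and> card e = 2" "card \<E> < 3 * card \<B>"
  shows "\<exists>A\<in>\<B>. card {e \<in> \<E>. A \<in> e} \<le> 5"
proof (rule ccontr)
  assume "\<not> ?thesis"
  then have *: "6 \<le> card {e \<in> \<E>. A \<in> e}" if "A \<in> \<B>" for A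
    using that by force
  have "card {A \<in> \<B>. A \<in> e} = 2" if "e \<in> \<E>" for e
  proof -
    have "{A \<in> \<B>. A \<in> e} = e" using assms(3)[OF that] by blast
    then show ?thesis using assms(3)[OF that] by simp
  qed
  then have "(\<Sum>A\<in>\<B>. card {e \<in> \<E>. A \<in> e}) = 2 * card \<E>"
    using assms(1,2) by (intro sum_multicount) auto
  moreover have "(\<Sum>A\<in>\<B>. card {e \<in> \<E>. A \<in> e}) \<ge> (\<Sum>A\<in>\<B>. 6)"
    using * by (intro sum_mono) auto
  ultimately show False
    using assms(4) by simp
qed

lemma incident_eq_neighbours:
  assumes "\<And>e. e \<in> \<E> \<Longrightarrow> card e = 2"
  shows "card {e \<in> \<E>. A \<in> e} = card {B. {A, B} \<in> \<E>}"
proof -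
  have "{e \<in> \<E>. A \<in> e} = (\<lambda>B. {A, B}) ` {B. {A, B} \<in> \<E>}"
  proof (intro equalityI subsetI)
    fix e assume "e \<in> {e \<in> \<E>. A \<in> e}"
    then have "e \<in> \<E>" "A \<in> e" "card e = 2"
      using assms by auto
    then obtain B where "e = {A, B}"
      by (auto simp: card_2_iff)
    then show "e \<in> (\<lambda>B. {A, B}) ` {B. {A, B} \<in> \<E>}"
      using \<open>e \<in> \<E>\<close> by blast
  qed auto
  moreover have "inj_on (\<lambda>B. {A, B}) {B. {A, B} \<in> \<E>}"
    by (auto simp: inj_on_def doubleton_eq_iff)
  ultimately show ?thesis
    by (simp add: card_image)
qed

text \<open>Each element misses at most one other, so the unrelated pairs form a matching on five
  elements. They are among two pairs, named \<open>{a, b}\<close> and \<open>{c, d}\<close>, and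
  \<open>e\<close> is related to everything.\<close>

lemma five_elements_nearly_complete:
  assumes "card N = 5" and sym: "\<And>x y. r x y \<Longrightarrow> r y x"
    and deg: "\<And>x. x \<in> N \<Longrightarrow> 3 \<le> card {y \<in> N - {x}. r x y}"
  obtains a b c d e where "N = {a, b, c, d, e}" "distinct [a, b, c, d, e]"
    "r a c" "r b c" "r a d" "r b d" "r a e" "r b e" "r c e" "r d e"
proof -
  have fin: "finite N" using assms(1) card.infinite by fastforce
  have two: "r x y \<or> r x z" if "x \<in> N" "y \<in> N" "z \<in> N" "x \<noteq> y" "x \<noteq> z" "y \<noteq> z" for x y z
  proof (rule ccontr)
    assume "\<not> ?thesis"
    then have "{w \<in> N - {x}. r x w} \<subseteq> N - {x, y, z}" by blast
    then have "card {w \<in> N - {x}. r x w} \<le> card (N - {x, y, z})"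
      using fin by (intro card_mono) auto
    also have "\<dots> = 2"
      using that assms(1) fin by (simp add: card_Diff_subset)
    finally show False using deg[OF that(1)] by simp
  qed
  \<comment> \<open>An unrelated pair if there is one; otherwise any pair will do.\<close>
  obtain a b where ab: "a \<in> N" "b \<in> N" "a \<noteq> b" "\<not> r a b \<or> (\<forall>x\<in>N. \<forall>y\<in>N. x \<noteq> y \<longrightarrow> r x y)"
  proof (cases "\<forall>x\<in>N. \<forall>y\<in>N. x \<noteq> y \<longrightarrow> r x y")
    case True
    have "\<not> card N \<le> Suc 0" using assms(1) by simp
    then obtain a b where "a \<in> N" "b \<in> N" "a \<noteq> b"
      unfolding card_le_Suc0_iff_eq[OF fin] by blast
    with True that show ?thesis by blast
  qed (use that in blast)
  have "card (N - {a, b}) = 3"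
    using ab assms(1) fin by (simp add: card_Diff_subset)
  then obtain c d e where cde: "N - {a, b} = {c, d, e}" "c \<noteq> d" "c \<noteq> e" "d \<noteq> e"
    by (auto simp: card_3_iff)
  have N: "N = {a, b, c, d, e}" using cde(1) ab by blast
  have dist: "distinct [a, b, c, d, e]" using cde ab(3) by auto
  have ra: "r a x" "r b x" if "x \<in> {c, d, e}" for x
  proof -
    have x: "x \<in> N" "x \<noteq> a" "x \<noteq> b" using that cde(1) by auto
    show "r a x" using ab(4) two[of a b x] ab x by auto
    show "r b x" using ab(4) two[of b a x] ab x sym by metis
  qed
  \<comment> \<open>If \<open>e\<close> misses \<open>c\<close> or \<open>d\<close>, it trades its
    role with the third element of \<open>{c, d, e}\<close>.\<close>
  consider "r c e" "r d e" | "\<not> r c e" | "\<not> r d e" by blast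
  then show thesis
  proof cases
    case 1
    then show ?thesis using that[of a b c d e] N dist ra by simp
  next
    case 2
    then have "r c d" "r e d"
      using two[of c e d] two[of e c d] N dist sym by auto
    then show ?thesis using that[of a b c e d] N dist ra sym by (auto simp: insert_commute)
  next
    case 3
    then have "r d c" "r e c"
      using two[of d e c] two[of e d c] N dist sym by auto
    then show ?thesis using that[of a b d e c] N dist ra sym by (auto simp: insert_commute)
  qed
qed

lemma branch_sets_mono:
  assumes "branch_sets G \<B>" "\<A> \<subseteq> \<B>"
  shows "branch_sets G \<A>"
proof -
  have B: "finite \<B>" "pairwise disjnt \<B>" "\<forall>B\<in>\<B>. B \<noteq> {} \<and> B \<subseteq> verts G \<and> connected_in G B"
    using assms(1) by (simp_all add: branch_sets_def)
  show ?thesis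
    unfolding branch_sets_def
    using finite_subset[OF assms(2) B(1)] pairwise_subset[OF B(2) assms(2)] B(3) assms(2) by blast
qed

lemma branch_sets_Un:
  assumes "branch_sets G \<B>" "A \<in> \<B>" "B \<in> \<B>" "A \<noteq> B" "touching G A B"
  shows "branch_sets G (insert (A \<union> B) (\<B> - {A, B}))" "A \<union> B \<notin> \<B>"
    "card (insert (A \<union> B) (\<B> - {A, B})) = card \<B> - 1"
proof -
  have fin: "finite \<B>" and dis: "pairwise disjnt \<B>" and
    each: "\<And>X. X \<in> \<B> \<Longrightarrow> X \<noteq> {} \<and> X \<subseteq> verts G \<and> connected_in G X"
    using assms(1) by (auto simp: branch_sets_def)
  have AB: "disjnt X Y" if "X \<in> \<B>" "Y \<in> \<B>" "X \<noteq> Y" for X Y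
    using dis that by (simp add: pairwise_def)
  show notin: "A \<union> B \<notin> \<B>"
  proof
    assume "A \<union> B \<in> \<B>"
    moreover have "A \<union> B \<noteq> A"
      using AB[OF assms(2,3,4)] each[OF assms(3)] by (auto simp: disjnt_def)
    ultimately show False
      using AB[of "A \<union> B" A] assms(2) each[OF assms(2)] by (auto simp: disjnt_def)
  qed
  have "pairwise disjnt (insert (A \<union> B) (\<B> - {A, B}))"
    using AB assms(2,3) unfolding pairwise_def by (auto simp: disjnt_Un1 disjnt_Un2)
  moreover have "connected_in G (A \<union> B)"
    using connected_in_Un each assms by blast
  ultimately show "branch_sets G (insert (A \<union> B) (\<B> - {A, B}))"
    using fin each assms(2,3) unfolding branch_sets_def by auto
  have "card (\<B> - {A, B}) = card \<B> - 2"
    using assms(2-4) fin by (simp add: card_Diff_subset)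
  moreover have "2 \<le> card \<B>"
    using card_mono[OF fin, of "{A, B}"] assms(2-4) by simp
  ultimately show "card (insert (A \<union> B) (\<B> - {A, B})) = card \<B> - 1"
    using notin fin by simp
qed

text \<open>Mader's argument: a contraction loses one edge plus one for every common neighbour, so in a
  minimal counterexample all edges lie in three triangles, and a vertex of degree at most five
  together with its neighbours then contracts to \<open>K\<^sub>5\<close>.\<close>

lemma edge_bound_branch_sets:
  assumes "planar G" "simple_graph G"
  shows "branch_sets G \<B> \<Longrightarrow> 3 \<le> card \<B> \<Longrightarrow>
    \<forall>e\<in>\<E>. \<exists>A\<in>\<B>. \<exists>B\<in>\<B>. e = {A, B} \<and> A \<noteq> B \<and> touching G A B \<Longrightarrow> card \<E> + 6 \<le> 3 * card \<B>"
proof (induction "card \<B>" arbitrary: \<B> \<E> rule: less_induct)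
  case less
  have fin: "finite \<B>"
    using less.prems(1) by (simp add: branch_sets_def)
  have sub: "e \<subseteq> \<B> \<and> card e = 2" if e: "e \<in> \<E>" for e
  proof -
    obtain A B where "A \<in> \<B>" "B \<in> \<B>" "e = {A, B}" "A \<noteq> B"
      using bspec[OF less.prems(3) e] by (elim bexE conjE)
    then show ?thesis by simp
  qed
  then have "\<E> \<subseteq> {e. e \<subseteq> \<B> \<and> card e = 2}" by blast
  then have finE: "finite \<E>"
    by (rule finite_subset) (use fin in simp)
  show ?case
  proof (rule ccontr)
    assume neg: "\<not> ?thesis"
    have "card \<B> \<noteq> 3"
    proof
      assume "card \<B> = 3"
      then have "card {e. e \<subseteq> \<B> \<and> card e = 2} = 3"
        by (simp add: n_subsets[OF fin] numeral_eq_Suc)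
      moreover have "card \<E> \<le> card {e. e \<subseteq> \<B> \<and> card e = 2}"
        using sub fin by (intro card_mono) auto
      ultimately show False using neg \<open>card \<B> = 3\<close> by simp
    qed
    then have n4: "4 \<le> card \<B>" using less.prems(2) by simp
    \<comment> \<open>One edge more than the bound allows, but no further ones, so that the average
      degree stays below six.\<close>
    obtain F where F: "F \<subseteq> \<E>" "card F = 3 * card \<B> - 5"
    proof -
      have "3 * card \<B> - 5 \<le> card \<E>" using neg by linarith
      then show thesis using obtain_subset_with_card_n that by metis
    qed
    have finF: "finite F" using F(1) finE finite_subset by blast
    have Fsub: "e \<subseteq> \<B> \<and> card e = 2" if "e \<in> F" for e
      using F(1) sub that by blast
    have Fedge: "A \<in> \<B> \<and> B \<in> \<B> \<and> A \<noteq> B \<and> touching G A B" if AB: "{A, B} \<in> F" for A B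
    proof -
      obtain X Y where "X \<in> \<B>" "Y \<in> \<B>" "{A, B} = {X, Y}" "X \<noteq> Y" "touching G X Y"
        using bspec[OF less.prems(3) subsetD[OF F(1) AB]] by (elim bexE conjE)
      then show ?thesis
        using touching_sym[of G X Y] by (auto simp: doubleton_eq_iff)
    qed
    obtain A where A: "A \<in> \<B>" "card {e \<in> F. A \<in> e} \<le> 5"
      using exists_low_degree[of \<B> F] fin finF Fsub F(2) n4 by auto
    define N where "N = {B. {A, B} \<in> F}"
    have NB: "N \<subseteq> \<B>" using Fedge by (auto simp: N_def)
    then have finN: "finite N" using fin finite_subset by blast
    have cN: "card N \<le> 5"
      using A(2) incident_eq_neighbours[of F A] Fsub by (simp add: N_def)
    \<comment> \<open>Otherwise \<open>A\<close> could be dropped, and fewer branch sets would still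
      carry all of \<open>F\<close>.\<close>
    have N0: "N \<noteq> {}"
    proof
      assume N: "N = {}"
      have "\<exists>X\<in>\<B> - {A}. \<exists>Y\<in>\<B> - {A}. e = {X, Y} \<and> X \<noteq> Y \<and> touching G X Y" if e: "e \<in> F" for e
      proof -
        obtain X Y where XY: "X \<in> \<B>" "Y \<in> \<B>" "e = {X, Y}" "X \<noteq> Y" "touching G X Y"
          using bspec[OF less.prems(3) subsetD[OF F(1) e]] by (elim bexE conjE)
        moreover have "X \<noteq> A" "Y \<noteq> A"
          using N e XY(3) by (auto simp: N_def insert_commute)
        ultimately show ?thesis by blast
      qed
      moreover have "card (\<B> - {A}) < card \<B>" "3 \<le> card (\<B> - {A})"
        using n4 A(1) fin by auto
      moreover have "branch_sets G (\<B> - {A})"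
        by (rule branch_sets_mono[OF less.prems(1)]) auto
      ultimately have "card F + 6 \<le> 3 * card (\<B> - {A})"
        by (intro less.hyps ballI)
      then show False
        using F(2) n4 A(1) fin by simp
    qed
    \<comment> \<open>With at most two common neighbours, contracting \<open>{A, B}\<close> would
      lose at most three edges, which is what the bound drops by.\<close>
    have tri: "3 \<le> card {C \<in> N - {B}. {B, C} \<in> F}" if B: "B \<in> N" for B
    proof (rule ccontr)
      assume few: "\<not> ?thesis"
      have AB: "A \<in> \<B>" "B \<in> \<B>" "A \<noteq> B" "touching G A B"
        using Fedge B by (auto simp: N_def)
      define C where "C = {X. {A, X} \<in> F \<and> {B, X} \<in> F}"
      have "C = {C \<in> N - {B}. {B, C} \<in> F}"
        using Fedge by (auto simp: C_def N_def)
      then have C: "finite C" "card C \<le> 2"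
        using few finN by auto
      define \<phi> where "\<phi> = (\<lambda>X. if X = A \<or> X = B then A \<union> B else X)"
      define F' where "F' = (`) \<phi> ` (F - {{A, B}})"
      note U = branch_sets_Un[OF less.prems(1) AB]
      have "card F \<le> card F' + 3"
        unfolding F'_def \<phi>_def
      proof (rule card_contract_edges)
        show "A \<union> B \<notin> \<Union>F" using U(2) Fsub by blast
      qed (use finF Fsub AB C in \<open>auto simp: C_def\<close>)
      moreover have "card F' + 6 \<le> 3 * card (insert (A \<union> B) (\<B> - {A, B}))"
      proof (intro less.hyps U ballI)
        show "card (insert (A \<union> B) (\<B> - {A, B})) < card \<B>"
          "3 \<le> card (insert (A \<union> B) (\<B> - {A, B}))"
          unfolding U(3) using n4 by auto
        fix e assume "e \<in> F'"
        then obtain e' where e': "e' \<in> F" "e' \<noteq> {A, B}" "e = \<phi> ` e'"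
          by (auto simp: F'_def)
        then obtain X Y where XY: "e' = {X, Y}" "X \<noteq> Y"
          using Fsub by (meson card_2_iff)
        have tXY: "X \<in> \<B>" "Y \<in> \<B>" "touching G X Y"
          using Fedge e'(1) XY by auto
        have mem: "\<phi> Z \<in> insert (A \<union> B) (\<B> - {A, B})" "Z \<subseteq> \<phi> Z" if "Z \<in> \<B>" for Z
          using that by (auto simp: \<phi>_def)
        have "touching G (\<phi> X) (\<phi> Y)"
          using tXY(3) mem(2)[OF tXY(1)] mem(2)[OF tXY(2)] unfolding touching_def by blast
        moreover have "\<phi> X \<noteq> \<phi> Y"
          using XY e'(2) U(2) tXY by (auto simp: \<phi>_def insert_commute split: if_splits)
        ultimately show "\<exists>X\<in>insert (A \<union> B) (\<B> - {A, B}). \<exists>Y\<in>insert (A \<union> B) (\<B> - {A, B}).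
            e = {X, Y} \<and> X \<noteq> Y \<and> touching G X Y"
          using mem(1)[OF tXY(1)] mem(1)[OF tXY(2)] e'(3) XY(1)
          by (intro bexI[of _ "\<phi> X"] bexI[of _ "\<phi> Y"] conjI) simp_all
      qed
      ultimately show False
        using U(3) F(2) n4 by simp
    qed
    have A_N: "touching G A B" "A \<noteq> B" "touching G B A" if "B \<in> N" for B
      using Fedge that touching_sym[of G] by (auto simp: N_def)
    have AnotN: "A \<notin> N" using A_N by blast
    show False
    proof (cases "card N = 5")
      case True
      have sym: "{x, y} \<in> F \<Longrightarrow> {y, x} \<in> F" for x y
        by (simp add: insert_commute)
      obtain a b c d e where N: "N = {a, b, c, d, e}" "distinct [a, b, c, d, e]" and
        r: "{a, c} \<in> F" "{b, c} \<in> F" "{a, d} \<in> F" "{b, d} \<in> F" "{a, e} \<in> F" "{b, e} \<in> F"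
           "{c, e} \<in> F" "{d, e} \<in> F"
        by (rule five_elements_nearly_complete[of N "\<lambda>x y. {x, y} \<in> F", OF True sym tri])
      have abcde: "a \<in> \<B>" "b \<in> \<B>" "c \<in> \<B>" "d \<in> \<B>" "e \<in> \<B>" "a \<noteq> c"
        using N NB by auto
      note t = r[THEN Fedge]
      \<comment> \<open>The only pairs not known to touch are \<open>{a, b}\<close> and
        \<open>{c, d}\<close>. Merging \<open>a\<close> with \<open>c\<close> repairs both, since
        \<open>c\<close> touches \<open>b\<close> and \<open>a\<close> touches
        \<open>d\<close>.\<close>
      note U = branch_sets_Un[OF less.prems(1) abcde(1,3,6)]
      have ac: "touching G a c" using t by blast
      have neq: "A \<noteq> a" "A \<noteq> b" "A \<noteq> c" "A \<noteq> d" "A \<noteq> e" "a \<noteq> b" "a \<noteq> d" "a \<noteq> e" "b \<noteq> c" "b \<noteq> d"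
        "b \<noteq> e" "c \<noteq> d" "c \<noteq> e" "d \<noteq> e"
        using N(2) AnotN unfolding N(1) by simp_all
      have "branch_sets G {A, a \<union> c, b, d, e}"
        by (rule branch_sets_mono[OF U(1)[OF ac]]) (use A(1) abcde neq in simp)
      moreover have "a \<union> c \<noteq> X" "X \<noteq> a \<union> c" if "X \<in> \<B>" for X
        using U(2)[OF ac] that by metis+
      then have "card {A, a \<union> c, b, d, e} = 5"
        using neq A(1) abcde by (simp add: card_insert_if)
      moreover have "pairwise (touching G) {A, a \<union> c, b, d, e}"
      proof -
        have un: "touching G X Z \<Longrightarrow> touching G (X \<union> Y) Z" "touching G Y Z \<Longrightarrow> touching G (X \<union> Y) Z" for X Y Z
          unfolding touching_def by blast+
        have inN: "a \<in> N" "b \<in> N" "d \<in> N" "e \<in> N"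
          unfolding N(1) by simp_all
        have tt: "touching G a d" "touching G a e" "touching G c b" "touching G b d" "touching G b e" "touching G d e"
          using t touching_sym by blast+
        have "touching G A (a \<union> c)" "touching G A b" "touching G A d" "touching G A e"
          "touching G (a \<union> c) b" "touching G (a \<union> c) d" "touching G (a \<union> c) e"
          "touching G b d" "touching G b e" "touching G d e"
          using tt A_N(1)[OF inN(2)] A_N(1)[OF inN(3)] A_N(1)[OF inN(4)]
            touching_sym[OF un(1)[OF A_N(3)[OF inN(1)]]] un(2)[OF tt(3)] un(1)[OF tt(1)] un(1)[OF tt(2)]
          by simp_all
        then show ?thesis
          unfolding pairwise_insert by (blast intro: touching_sym pairwise_empty)
      qed
      ultimately show False
        using planar_no_K5_minor[OF assms] by blast
    next
      case False
      obtain B0 where B0: "B0 \<in> N" using N0 by blast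
      \<comment> \<open>A neighbour of \<open>A\<close> has three further neighbours inside
        \<open>N\<close>. So \<open>N\<close> has exactly four elements, and these touch
        pairwise.\<close>
      have "3 \<le> card (N - {B0})"
        using tri[OF B0] card_mono[of "N - {B0}" "{C \<in> N - {B0}. {B0, C} \<in> F}"] finN by fastforce
      then have N4: "card N = 4"
        using False cN B0 finN by (simp add: card_Diff_singleton_if)
      have all: "touching G B C" if BC: "B \<in> N" "C \<in> N" "B \<noteq> C" for B C
      proof -
        have "{C \<in> N - {B}. {B, C} \<in> F} = N - {B}"
          using tri[OF BC(1)] BC(1) N4 finN by (intro card_seteq) auto
        then show ?thesis using BC Fedge by blast
      qed
      have "branch_sets G (insert A N)"
        by (rule branch_sets_mono[OF less.prems(1)]) (use NB A(1) in auto)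
      moreover have "card (insert A N) = 5"
        using AnotN finN N4 by simp
      moreover have "pairwise (touching G) (insert A N)"
        using all A_N by (auto simp: pairwise_def)
      ultimately show False
        using planar_no_K5_minor[OF assms] by blast
    qed
  qed
qed

lemma planar_edge_bound:
  assumes "planar G" "simple_graph G" "3 \<le> card (verts G)"
  shows "card (edges G) + 6 \<le> 3 * card (verts G)"
proof -
  define s where "s = (\<lambda>x::'a. {x})"
  have inj: "inj s" by (simp add: s_def inj_def)
  have "branch_sets G (s ` verts G)"
    using assms(2) by (auto simp: branch_sets_def simple_graph_def s_def connected_in_singleton pairwise_def)
  moreover have "\<forall>e\<in>(`) s ` edges G. \<exists>A\<in>s ` verts G. \<exists>B\<in>s ` verts G. e = {A, B} \<and> A \<noteq> B \<and> touching G A B"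
  proof
    fix e assume "e \<in> (`) s ` edges G"
    then obtain f where f: "f \<in> edges G" "e = s ` f" by blast
    then obtain x y where "f = {x, y}" "x \<noteq> y" "x \<in> verts G" "y \<in> verts G"
      using assms(2) unfolding simple_graph_def by (metis card_2_iff insert_subset)
    then show "\<exists>A\<in>s ` verts G. \<exists>B\<in>s ` verts G. e = {A, B} \<and> A \<noteq> B \<and> touching G A B"
      using f by (auto simp: s_def touching_def)
  qed
  moreover have "card (s ` verts G) = card (verts G)" "card ((`) s ` edges G) = card (edges G)"
    using inj inj_on_subset[OF inj] by (auto intro!: card_image inj_onI simp: inj_image_eq_iff)
  ultimately show ?thesis
    using edge_bound_branch_sets[OF assms(1,2), of "s ` verts G" "(`) s ` edges G"] assms(3) by simp
qed

section \<open>Gluing a book to a vertex of a planar graph\<close>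

lemma closed_segments_meet_only_at_center:
  fixes c :: "'a::real_normed_vector"
  assumes "x \<in> closed_segment c a" "x \<in> closed_segment c b" "dist c a = dist c b" "a \<noteq> b"
  shows "x = c"
proof -
  obtain s where s: "x = (1 - s) *\<^sub>R c + s *\<^sub>R a" "0 \<le> s"
    using assms(1) by (auto simp: in_segment)
  obtain t where t: "x = (1 - t) *\<^sub>R c + t *\<^sub>R b" "0 \<le> t"
    using assms(2) by (auto simp: in_segment)
  have sa: "x - c = s *\<^sub>R (a - c)" and tb: "x - c = t *\<^sub>R (b - c)"
    by (simp add: s(1) algebra_simps) (simp add: t(1) algebra_simps)
  have "s * norm (a - c) = t * norm (b - c)"
    using arg_cong[OF sa, of norm] arg_cong[OF tb, of norm] s(2) t(2) by simp
  moreover have n: "norm (a - c) = norm (b - c)"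
    using assms(3) by (simp add: dist_norm norm_minus_commute)
  ultimately have "s = t \<or> norm (a - c) = 0" by auto
  then show ?thesis
  proof
    assume "s = t"
    have "s *\<^sub>R (a - b) = s *\<^sub>R (a - c) - s *\<^sub>R (b - c)"
      by (simp add: algebra_simps)
    then have "s *\<^sub>R (a - b) = 0"
      using sa tb \<open>s = t\<close> by (metis diff_self)
    then show ?thesis using assms(4) sa by auto
  next
    assume "norm (a - c) = 0"
    then show ?thesis using n assms(4) by simp
  qed
qed

text \<open>Cut \<open>h\<close> at its last visit to the disc and replace everything before by a
  radius. The rest never returns to the disc, so the result is again simple.\<close>

lemma arc_straighten_start:
  fixes h :: "real \<Rightarrow> 'a::real_normed_vector"
  assumes "arc h" "\<epsilon> > 0" "pathstart h = c" "pathfinish h \<notin> cball c \<epsilon>"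
  obtains g a where "arc g" "pathstart g = c" "pathfinish g = pathfinish h" "a \<in> path_image h"
    "dist c a = \<epsilon>" "path_image g \<subseteq> closed_segment c a \<union> (path_image h - cball c \<epsilon>)"
proof -
  have cont: "continuous_on {0..1} h"
    using assms(1) by (simp add: arc_def path_def)
  define T where "T = {t \<in> {0..1}. dist c (h t) \<le> \<epsilon>}"
  have "T = {0..1} \<inter> h -` cball c \<epsilon>"
    by (auto simp: T_def)
  then have "closed T"
    using continuous_closed_preimage[OF cont closed_real_atLeastAtMost closed_cball] by simp
  moreover have "bounded T"
    by (rule bounded_subset[of "{0..1}"]) (auto simp: T_def)
  ultimately have "compact T"
    by (simp add: compact_eq_bounded_closed)
  moreover have "0 \<in> T"
    using assms(2,3) by (simp add: T_def pathstart_def)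
  ultimately obtain s where s: "s \<in> T" "\<And>t. t \<in> T \<Longrightarrow> t \<le> s"
    using compact_attains_sup[of T] by blast
  have s01: "0 \<le> s" "s \<le> 1" and ds: "dist c (h s) \<le> \<epsilon>"
    using s(1) by (auto simp: T_def)
  have h1: "\<epsilon> < dist c (h 1)"
    using assms(4) by (simp add: pathfinish_def)
  \<comment> \<open>The last visit is on the circle itself: from the interior, the curve would have
    to cross the circle later on.\<close>
  have de: "dist c (h s) = \<epsilon>"
  proof -
    have "\<exists>t\<ge>s. t \<le> 1 \<and> dist c (h t) = \<epsilon>"
      using ds h1 s01 cont
      by (intro IVT') (auto intro!: continuous_intros elim: continuous_on_subset)
    then obtain t where t: "s \<le> t" "t \<le> 1" "dist c (h t) = \<epsilon>" by blast
    then have "t \<in> T" using s01 by (simp add: T_def)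
    then show ?thesis using s(2)[of t] t by simp
  qed
  have s1: "s \<noteq> 1" using h1 de by auto
  have tail: "x = h s \<or> x \<in> path_image h - cball c \<epsilon>" if x: "x \<in> path_image (subpath s 1 h)" for x
  proof -
    obtain t where t: "s \<le> t" "t \<le> 1" "x = h t"
      using x s01 by (auto simp: path_image_subpath)
    then show ?thesis
      using s(2)[of t] s01 by (cases "t = s") (auto simp: T_def path_image_def)
  qed
  have cne: "c \<noteq> h s" using de assms(2) by auto
  show thesis
  proof
    show "arc (linepath c (h s) +++ subpath s 1 h)"
    proof (rule arc_join)
      show "arc (subpath s 1 h)"
        using arc_subpath_arc[OF assms(1)] s01 s1 by auto
      show "path_image (linepath c (h s)) \<inter> path_image (subpath s 1 h) \<subseteq> {pathstart (subpath s 1 h)}"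
      proof
        fix x assume x: "x \<in> path_image (linepath c (h s)) \<inter> path_image (subpath s 1 h)"
        then have "x \<in> closed_segment c (h s)" by simp
        then have "x \<in> cball c \<epsilon>"
          using de by (metis convex_cball convex_contains_segment centre_in_cball assms(2) less_imp_le mem_cball order_refl subsetD)
        then show "x \<in> {pathstart (subpath s 1 h)}"
          using tail[of x] x by (auto simp: pathstart_def subpath_def)
      qed
    qed (use cne in \<open>auto simp: pathstart_def subpath_def\<close>)
    show "pathfinish (linepath c (h s) +++ subpath s 1 h) = pathfinish h"
      by (simp add: pathfinish_subpath) (simp add: pathfinish_def)
    show "h s \<in> path_image h"
      using s01 by (auto simp: path_image_def)
    show "path_image (linepath c (h s) +++ subpath s 1 h) \<subseteq> closed_segment c (h s) \<union> (path_image h - cball c \<epsilon>)"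
      using path_image_join_subset[of "linepath c (h s)" "subpath s 1 h"] tail by fastforce
  qed (use de in auto)
qed

lemma finite_edges: "simple_graph G \<Longrightarrow> finite (edges G)"
  by (rule finite_subset[of _ "Pow (verts G)"]) (auto simp: simple_graph_def)

lemma edge_other_end:
  assumes "simple_graph G" "e \<in> edges G" "u \<in> e"
  obtains v where "e = {u, v}" "v \<noteq> u" "u \<in> verts G" "v \<in> verts G"
proof -
  have e: "e \<subseteq> verts G" "card e = 2"
    using assms by (auto simp: simple_graph_def)
  obtain x y where xy: "e = {x, y}" "x \<noteq> y"
    using e(2) by (auto simp: card_2_iff)
  show thesis
    using assms(3) that[of x] that[of y] xy e(1) by (auto simp: insert_commute)
qed

text \<open>The disc avoids everything not incident with \<open>u\<close>, so only the arcs at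
  \<open>u\<close> change. Each becomes a radius inside the disc and keeps only points of the old
  arc outside, so new crossings could arise only between radii.\<close>

lemma drawing_radial:
  assumes G: "simple_graph G" and d: "drawing G p \<gamma>" and u: "u \<in> verts G"
  obtains \<gamma>' \<epsilon> A where "drawing G p \<gamma>'" "\<epsilon> > 0" "finite A"
    "\<And>v. v \<in> verts G \<Longrightarrow> v \<noteq> u \<Longrightarrow> p v \<notin> cball (p u) \<epsilon>"
    "\<And>e x. e \<in> edges G \<Longrightarrow> x \<in> path_image (\<gamma>' e) \<Longrightarrow> x \<in> cball (p u) \<epsilon> \<Longrightarrow> \<exists>a\<in>A. x \<in> closed_segment (p u) a"
proof -
  note dG = drawingD[OF d]
  have eV: "e \<subseteq> verts G" if "e \<in> edges G" for e
    using G that by (simp add: simple_graph_def)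
  define K where "K = (\<Union>e\<in>{e \<in> edges G. u \<notin> e}. path_image (\<gamma> e)) \<union> p ` (verts G - {u})"
  have "closed K"
    unfolding K_def
  proof (intro closed_Un closed_UN ballI)
    show "finite {e \<in> edges G. u \<notin> e}"
      using finite_edges[OF G] by simp
    show "closed (path_image (\<gamma> e))" if "e \<in> {e \<in> edges G. u \<notin> e}" for e
      using dG(2) that by (auto intro!: closed_path_image arc_imp_path)
    show "closed (p ` (verts G - {u}))"
      using G by (auto simp: simple_graph_def intro!: finite_imp_closed)
  qed
  moreover have "p u \<notin> K"
  proof
    assume "p u \<in> K"
    then consider e where "e \<in> edges G" "u \<notin> e" "p u \<in> path_image (\<gamma> e)" | v where "v \<in> verts G" "v \<noteq> u" "p u = p v"
      by (auto simp: K_def)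
    then show False
    proof cases
      case 1
      then have "p u \<in> p ` e" using dG(4) u by blast
      then show False
        using inj_on_image_mem_iff[OF dG(1) u eV[OF 1(1)]] 1(2) by simp
    next
      case 2
      then show False using inj_onD[OF dG(1), of u v] u by blast
    qed
  qed
  ultimately obtain \<epsilon> where \<epsilon>: "\<epsilon> > 0" "cball (p u) \<epsilon> \<subseteq> - K"
  proof -
    have "open (- K)" "p u \<in> - K"
      using \<open>closed K\<close> \<open>p u \<notin> K\<close> by auto
    then show thesis
      using that unfolding open_contains_cball by blast
  qed
  have Kv: "p v \<notin> cball (p u) \<epsilon>" if "v \<in> verts G" "v \<noteq> u" for v
  proof -
    have "p v \<in> K" using that by (auto simp: K_def)
    then show ?thesis using \<epsilon>(2) by blast
  qed
  have Ke: "x \<notin> cball (p u) \<epsilon>" if "e \<in> edges G" "u \<notin> e" "x \<in> path_image (\<gamma> e)" for e x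
  proof -
    have "x \<in> K" using that by (auto simp: K_def)
    then show ?thesis using \<epsilon>(2) by blast
  qed
  have seg: "closed_segment (p u) a \<subseteq> cball (p u) \<epsilon>" if "dist (p u) a = \<epsilon>" for a
    using that \<epsilon>(1) by (intro closed_segment_subset) auto
  have "\<exists>g a. e \<in> edges G \<and> u \<in> e \<longrightarrow> arc g \<and> {pathstart g, pathfinish g} = p ` e \<and> a \<in> path_image (\<gamma> e) \<and>
      dist (p u) a = \<epsilon> \<and> path_image g \<subseteq> closed_segment (p u) a \<union> (path_image (\<gamma> e) - cball (p u) \<epsilon>)" for e
  proof (cases "e \<in> edges G \<and> u \<in> e")
    case True
    then obtain v where v: "e = {u, v}" "v \<noteq> u" and vV: "v \<in> verts G"
      using edge_other_end[OF G] by metis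
    have ends: "{pathstart (\<gamma> e), pathfinish (\<gamma> e)} = {p u, p v}"
      using dG(3) True v by auto
    obtain h where h: "arc h" "pathstart h = p u" "pathfinish h = p v" "path_image h = path_image (\<gamma> e)"
    proof (cases "pathstart (\<gamma> e) = p u")
      case True
      then have "pathfinish (\<gamma> e) = p v" using ends by (metis doubleton_eq_iff)
      then show ?thesis using that[of "\<gamma> e"] True dG(2) \<open>e \<in> edges G \<and> u \<in> e\<close> by blast
    next
      case False
      then have "pathfinish (\<gamma> e) = p u" "pathstart (\<gamma> e) = p v" using ends by (metis doubleton_eq_iff)+
      then show ?thesis
        using that[of "reversepath (\<gamma> e)"] dG(2) \<open>e \<in> edges G \<and> u \<in> e\<close> by (simp add: arc_reversepath)
    qed
    obtain g a where "arc g" "pathstart g = p u" "pathfinish g = pathfinish h" "a \<in> path_image h"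
      "dist (p u) a = \<epsilon>" "path_image g \<subseteq> closed_segment (p u) a \<union> (path_image h - cball (p u) \<epsilon>)"
      using arc_straighten_start[OF h(1) \<epsilon>(1) h(2)] Kv[OF vV v(2)] h(3) by metis
    then show ?thesis
      using h v(1) by (intro exI[of _ g] exI[of _ a]) simp
  qed auto
  then obtain g a where ga: "\<And>e. e \<in> edges G \<Longrightarrow> u \<in> e \<Longrightarrow> arc (g e) \<and> {pathstart (g e), pathfinish (g e)} = p ` e \<and>
      a e \<in> path_image (\<gamma> e) \<and> dist (p u) (a e) = \<epsilon> \<and>
      path_image (g e) \<subseteq> closed_segment (p u) (a e) \<union> (path_image (\<gamma> e) - cball (p u) \<epsilon>)"
    by metis
  define \<gamma>' where "\<gamma>' e = (if u \<in> e then g e else \<gamma> e)" for e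
  have in_new: "u \<in> e \<and> x \<in> closed_segment (p u) (a e) \<and> x \<in> cball (p u) \<epsilon> \<or> x \<in> path_image (\<gamma> e) \<and> x \<notin> cball (p u) \<epsilon>"
    if "e \<in> edges G" "x \<in> path_image (\<gamma>' e)" for e x
  proof (cases "u \<in> e")
    case True
    then show ?thesis
      using ga[OF that(1) True] that(2) seg[of "a e"] by (auto simp: \<gamma>'_def)
  next
    case False
    then show ?thesis
      using that Ke by (auto simp: \<gamma>'_def)
  qed
  have vin: "x = p u" if "x \<in> p ` verts G" "x \<in> cball (p u) \<epsilon>" for x
    using that Kv by blast
  \<comment> \<open>The radii of two edges could end in the same point only at a vertex, and the
    disc contains no vertex besides its centre.\<close>
  have a_neq: "a e \<noteq> a f" if "e \<in> edges G" "f \<in> edges G" "u \<in> e" "u \<in> f" "e \<noteq> f" for e f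
  proof
    assume "a e = a f"
    then have "a e \<in> p ` verts G"
      using dG(6)[OF that(1,2,5)] ga[OF that(1,3)] ga[OF that(2,4)] by metis
    then have "a e = p u"
      using vin[of "a e"] ga[OF that(1,3)] by simp
    then show False
      using ga[OF that(1,3)] \<epsilon>(1) by simp
  qed
  have "drawing G p \<gamma>'"
    unfolding drawing_def
  proof (intro conjI ballI impI)
    show "inj_on p (verts G)" by (rule dG(1))
    fix e assume e: "e \<in> edges G"
    show "arc (\<gamma>' e)"
      using dG(2)[OF e] ga[OF e] by (simp add: \<gamma>'_def)
    show ends: "{pathstart (\<gamma>' e), pathfinish (\<gamma>' e)} = p ` e"
      using dG(3)[OF e] ga[OF e] by (simp add: \<gamma>'_def)
    show "path_image (\<gamma>' e) \<inter> p ` verts G = p ` e"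
    proof (intro equalityI subsetI)
      fix x assume "x \<in> path_image (\<gamma>' e) \<inter> p ` verts G"
      then show "x \<in> p ` e"
        using in_new[OF e, of x] vin[of x] dG(4)[OF e] by blast
    next
      fix x assume x: "x \<in> p ` e"
      then have "x \<in> path_image (\<gamma>' e)"
        using ends by (metis insertE pathfinish_in_path_image pathstart_in_path_image singletonD)
      then show "x \<in> path_image (\<gamma>' e) \<inter> p ` verts G"
        using x eV[OF e] by blast
    qed
    fix f assume f: "f \<in> edges G" "e \<noteq> f"
    show "path_image (\<gamma>' e) \<inter> path_image (\<gamma>' f) \<subseteq> p ` verts G"
    proof
      fix x assume "x \<in> path_image (\<gamma>' e) \<inter> path_image (\<gamma>' f)"
      then consider "u \<in> e" "u \<in> f" "x \<in> closed_segment (p u) (a e)" "x \<in> closed_segment (p u) (a f)" |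
        "x \<in> path_image (\<gamma> e)" "x \<in> path_image (\<gamma> f)"
        using in_new[OF e] in_new[OF f(1)] by blast
      then show "x \<in> p ` verts G"
      proof cases
        case 1
        then have "x = p u"
          using closed_segments_meet_only_at_center[OF 1(3,4)] ga[OF e 1(1)] ga[OF f(1) 1(2)] a_neq[OF e f(1) 1(1,2) f(2)] by simp
        then show ?thesis using u by blast
      next
        case 2
        then show ?thesis using dG(6)[OF e f] by blast
      qed
    qed
  qed
  moreover have "finite (a ` edges G)"
    using finite_edges[OF G] by simp
  moreover have "\<exists>b\<in>a ` edges G. x \<in> closed_segment (p u) b"
    if "e \<in> edges G" "x \<in> path_image (\<gamma>' e)" "x \<in> cball (p u) \<epsilon>" for e x
    using in_new[OF that(1,2)] that by blast
  ultimately show thesis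
    using that \<epsilon>(1) Kv by blast
qed

lemma drawing_affine:
  fixes c w :: complex
  assumes "drawing G p \<gamma>" "w \<noteq> 0"
  defines "T \<equiv> \<lambda>z. (z - c) / w"
  shows "drawing G (T \<circ> p) (\<lambda>e. T \<circ> \<gamma> e)"
proof -
  note dG = drawingD[OF assms(1)]
  have inj: "inj T"
    using assms(2) by (auto simp: T_def inj_def)
  have cont: "continuous_on S T" for S
    unfolding T_def by (intro continuous_intros) (use assms(2) in auto)
  have image: "(T \<circ> p) ` S = T ` p ` S" for S
    by (simp add: image_comp)
  show ?thesis
    unfolding drawing_def path_image_compose image
  proof (intro conjI ballI impI)
    show "inj_on (T \<circ> p) (verts G)"
      using dG(1) inj by (simp add: comp_inj_on inj_on_subset)
    fix e assume e: "e \<in> edges G"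
    show "arc (T \<circ> \<gamma> e)"
      using dG(2)[OF e] path_continuous_image[OF _ cont] comp_inj_on[OF _ inj_on_subset[OF inj subset_UNIV]]
      unfolding arc_def by blast
    have "{pathstart (T \<circ> \<gamma> e), pathfinish (T \<circ> \<gamma> e)} = T ` {pathstart (\<gamma> e), pathfinish (\<gamma> e)}"
      by (simp add: pathstart_def pathfinish_def)
    then show "{pathstart (T \<circ> \<gamma> e), pathfinish (T \<circ> \<gamma> e)} = T ` p ` e"
      using dG(3)[OF e] by simp
    have "path_image (\<gamma> e) \<inter> p ` verts G = p ` e"
      using assms(1) e unfolding drawing_def by blast
    then show "T ` path_image (\<gamma> e) \<inter> T ` p ` verts G = T ` p ` e"
      by (metis image_Int inj)
    fix f assume f: "f \<in> edges G" "e \<noteq> f"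
    have "path_image (\<gamma> e) \<inter> path_image (\<gamma> f) \<subseteq> p ` verts G"
      using dG(6)[OF e f] by blast
    then show "T ` path_image (\<gamma> e) \<inter> T ` path_image (\<gamma> f) \<subseteq> T ` p ` verts G"
      by (metis image_Int image_mono inj)
  qed
qed

text \<open>Finitely many radii leave some direction free, which is turned to the positive real
  axis. Between this axis and the smallest positive slope there is an empty sector, and scaling puts
  its part with \<open>Re x <= 2\<close> into the disc.\<close>

lemma planar_free_sector:
  assumes G: "simple_graph G" "planar G" "u \<in> verts G"
  obtains p \<gamma> \<sigma> where "drawing G p \<gamma>" "p u = 0" "\<sigma> > 0"
    "\<And>x. x \<in> p ` verts G \<union> (\<Union>e\<in>edges G. path_image (\<gamma> e)) \<Longrightarrow> 0 < Re x \<Longrightarrow> Re x \<le> 2 \<Longrightarrow>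
      0 \<le> Im x \<Longrightarrow> \<sigma> * Re x < Im x"
proof -
  obtain p \<gamma>0 where "drawing G p \<gamma>0"
    using G(2) planar_iff_drawing by blast
  then obtain \<gamma> \<epsilon> A where d: "drawing G p \<gamma>" and \<epsilon>: "\<epsilon> > 0" and A: "finite A" and
    v: "\<And>v. v \<in> verts G \<Longrightarrow> v \<noteq> u \<Longrightarrow> p v \<notin> cball (p u) \<epsilon>" and
    e: "\<And>e x. e \<in> edges G \<Longrightarrow> x \<in> path_image (\<gamma> e) \<Longrightarrow> x \<in> cball (p u) \<epsilon> \<Longrightarrow> \<exists>a\<in>A. x \<in> closed_segment (p u) a"
    using drawing_radial[OF G(1) _ G(3)] by blast
  define c where "c = p u"
  have "finite ((\<lambda>a. Im (a - c) / Re (a - c)) ` A)"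
    using A by simp
  \<comment> \<open>\<open>Complex 1 s\<close> is then parallel to no radius: it is never vertical,
    and all slopes of other radii are avoided.\<close>
  then obtain s where s: "s \<notin> (\<lambda>a. Im (a - c) / Re (a - c)) ` A"
    using ex_new_if_finite[OF infinite_UNIV_char_0] by blast
  define d' where "d' = Complex 1 s"
  have d'0: "d' \<noteq> 0" by (simp add: d'_def complex_eq_iff)
  define slope where "slope a = Im ((a - c) / d') / Re ((a - c) / d')" for a
  \<comment> \<open>The entry 1 keeps the set nonempty and bounds \<open>\<sigma>\<close> by 1;
    halving makes the comparison with the slopes strict.\<close>
  define \<sigma> where "\<sigma> = Min (insert 1 {x \<in> slope ` A. 0 < x}) / 2"
  have fin: "finite (insert 1 {x \<in> slope ` A. 0 < x})"
    using A by simp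
  have "0 < Min (insert 1 {x \<in> slope ` A. 0 < x})"
    using fin by (subst Min_gr_iff) auto
  then have \<sigma>0: "0 < \<sigma>" by (simp add: \<sigma>_def)
  have "Min (insert 1 {x \<in> slope ` A. 0 < x}) \<le> 1"
    using fin by (intro Min_le) auto
  then have \<sigma>1: "\<sigma> \<le> 1" by (simp add: \<sigma>_def)
  have \<sigma>slope: "\<sigma> < slope a" if "a \<in> A" "0 < slope a" for a
  proof -
    have "Min (insert 1 {x \<in> slope ` A. 0 < x}) \<le> slope a"
      using fin that by (intro Min_le) auto
    then show ?thesis using \<sigma>0 by (simp add: \<sigma>_def)
  qed
  \<comment> \<open>Points of the sector have real and imaginary part at most 2, hence modulus at
    most 4; dividing by 4 brings them into the disc of radius \<open>\<epsilon>\<close>.\<close>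
  define \<eta> where "\<eta> = \<epsilon> / (4 * cmod d')"
  have \<eta>: "0 < \<eta>" using \<epsilon> d'0 by (simp add: \<eta>_def)
  define w where "w = d' * of_real \<eta>"
  have w0: "w \<noteq> 0" using d'0 \<eta> by (simp add: w_def)
  define T where "T = (\<lambda>z. (z - c) / w)"
  have dT: "drawing G (T \<circ> p) (\<lambda>e. T \<circ> \<gamma> e)"
    unfolding T_def by (rule drawing_affine[OF d w0])
  have "\<sigma> * Re x < Im x"
    if x: "x \<in> (T \<circ> p) ` verts G \<union> (\<Union>e\<in>edges G. path_image (T \<circ> \<gamma> e))"
      and Re: "0 < Re x" "Re x \<le> 2" and Im: "0 \<le> Im x" for x
  proof (rule ccontr)
    assume "\<not> \<sigma> * Re x < Im x"
    then have Im': "Im x \<le> \<sigma> * Re x" by simp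
    also have "\<sigma> * Re x \<le> 1 * 2"
      using Re \<sigma>0 \<sigma>1 by (intro mult_mono) auto
    finally have "cmod x \<le> 4"
      using cmod_le[of x] Re Im by simp
    define y where "y = c + x * w"
    have injT: "z = y" if "T z = x" for z
      using that w0 by (auto simp: T_def y_def)
    have "dist c y = cmod x * cmod w"
      by (simp add: y_def dist_norm norm_mult)
    also have "\<dots> \<le> 4 * cmod w"
      using \<open>cmod x \<le> 4\<close> by (intro mult_right_mono) auto
    also have "\<dots> = \<epsilon>"
    proof -
      have "cmod w = cmod d' * \<eta>"
        using \<eta> by (simp add: w_def norm_mult)
      then show ?thesis using d'0 by (simp add: \<eta>_def)
    qed
    finally have ball: "y \<in> cball (p u) \<epsilon>" by (simp add: c_def)
    have "y \<in> p ` verts G \<union> (\<Union>e\<in>edges G. path_image (\<gamma> e))"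
      using x injT by (auto simp: path_image_compose)
    moreover have "y \<noteq> p u"
      using Re(1) w0 by (auto simp: y_def c_def)
    ultimately obtain e' where "e' \<in> edges G" "y \<in> path_image (\<gamma> e')"
      using v ball by blast
    then obtain a where a: "a \<in> A" "y \<in> closed_segment c a"
      using e ball by (auto simp: c_def)
    then obtain t where t: "0 \<le> t" "y = (1 - t) *\<^sub>R c + t *\<^sub>R a"
      by (auto simp: in_segment)
    have "x * w = t *\<^sub>R (a - c)"
      using t(2) by (simp add: y_def algebra_simps)
    then have "x * d' * of_real \<eta> = of_real t * (a - c)"
      by (simp add: w_def scaleR_conv_of_real mult.assoc)
    define b where "b = (a - c) / d'"
    have ab: "a - c = b * d'" using d'0 by (simp add: b_def)
    obtain r where r: "r = t / \<eta>" by blast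
    have "x = of_real r * b"
      using \<open>x * d' * of_real \<eta> = of_real t * (a - c)\<close> d'0 \<eta> unfolding ab r by (simp add: field_simps)
    then have x: "Re x = r * Re b" "Im x = r * Im b"
      by simp_all
    have "r \<noteq> 0" using x Re(1) by auto
    then have t0: "0 < r" using t(1) \<eta> r by (simp add: zero_less_divide_iff)
    have Reb: "0 < Re b" and Imb: "0 \<le> Im b"
      using Re(1) Im x t0 by (simp_all add: zero_less_mult_iff zero_le_mult_iff)
    have "Im b \<noteq> 0"
    proof
      assume "Im b = 0"
      then have "b = of_real (Re b)"
        by (simp add: complex_eq_iff)
      then have "Re (a - c) = Re b" "Im (a - c) = Re b * s"
        using ab by (simp_all add: d'_def \<open>Im b = 0\<close>)
      then have "Im (a - c) / Re (a - c) = s"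
        using Reb by simp
      then show False using s a(1) by blast
    qed
    then have "0 < slope a" using Reb Imb by (simp add: slope_def b_def)
    then have "\<sigma> < Im b / Re b"
      using \<sigma>slope[OF a(1)] by (simp add: slope_def b_def)
    then have "\<sigma> * Re b < Im b"
      using Reb by (simp add: field_simps)
    then have "\<sigma> * Re x < Im x"
      using t0 by (simp add: x mult.left_commute)
    then show False using Im' by simp
  qed
  then show thesis
    using that[OF dT] \<sigma>0 by (simp add: T_def c_def)
qed

section \<open>Books drawn with straight segments\<close>

lemma drawing_add_segments:
  assumes d: "drawing G p \<gamma>" and G: "simple_graph G"
    and inj: "inj_on p (verts G \<union> N)"
    and F: "\<And>e. e \<in> F \<Longrightarrow> e \<subseteq> verts G \<union> N \<and> card e = 2"
    and new: "\<And>e v. e \<in> edges G \<Longrightarrow> v \<in> N \<Longrightarrow> p v \<notin> path_image (\<gamma> e)"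
    and seg_vert: "\<And>x y v. {x, y} \<in> F \<Longrightarrow> v \<in> verts G \<union> N \<Longrightarrow> p v \<in> closed_segment (p x) (p y) \<Longrightarrow> v = x \<or> v = y"
    and seg_seg: "\<And>x y x' y' z. {x, y} \<in> F \<Longrightarrow> {x', y'} \<in> F \<Longrightarrow> {x, y} \<noteq> {x', y'} \<Longrightarrow>
      z \<in> closed_segment (p x) (p y) \<Longrightarrow> z \<in> closed_segment (p x') (p y') \<Longrightarrow> z \<in> p ` (verts G \<union> N)"
    and seg_arc: "\<And>x y e z. {x, y} \<in> F \<Longrightarrow> e \<in> edges G \<Longrightarrow> z \<in> closed_segment (p x) (p y) \<Longrightarrow>
      z \<in> path_image (\<gamma> e) \<Longrightarrow> z \<in> p ` (verts G \<union> N)"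
  shows "planar (verts G \<union> N, edges G \<union> F)"
proof -
  note dG = drawingD[OF d]
  have eV: "e \<subseteq> verts G" if "e \<in> edges G" for e
    using G that by (simp add: simple_graph_def)
  have "\<exists>x y. e \<in> F \<longrightarrow> e = {x, y} \<and> x \<noteq> y \<and> x \<in> verts G \<union> N \<and> y \<in> verts G \<union> N" for e
    using F[of e] by (cases "e \<in> F") (auto simp: card_2_iff)
  then obtain x y where xy: "\<And>e. e \<in> F \<Longrightarrow> e = {x e, y e} \<and> x e \<noteq> y e \<and> x e \<in> verts G \<union> N \<and> y e \<in> verts G \<union> N"
    by metis
  \<comment> \<open>An edge that is already in \<open>G\<close> keeps its arc, so \<open>F\<close>
    may overlap \<open>edges G\<close>.\<close>
  define \<gamma>' where "\<gamma>' e = (if e \<in> edges G then \<gamma> e else linepath (p (x e)) (p (y e)))" for e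
  have F': "{x e, y e} \<in> F" if "e \<in> F" for e
    using xy[OF that] that by simp
  have old: "z \<in> p ` e" if "e \<in> edges G" "z \<in> path_image (\<gamma> e)" "z \<in> p ` (verts G \<union> N)" for e z
    using that new dG(4) by blast
  have cross: "z \<in> p ` (verts G \<union> N)" if ef: "e \<in> edges G \<union> F" "f \<in> edges G \<union> F" "e \<noteq> f"
     "z \<in> path_image (\<gamma>' e)" "z \<in> path_image (\<gamma>' f)" for e f z
  proof -
    consider "e \<in> edges G" "f \<in> edges G" | "e \<in> edges G" "f \<in> F" "f \<notin> edges G" |
       "e \<in> F" "e \<notin> edges G" "f \<in> edges G" | "e \<in> F" "e \<notin> edges G" "f \<in> F" "f \<notin> edges G"
      using ef(1,2) by blast
    then show ?thesis
    proof cases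
      case 1
      then show ?thesis using dG(6)[OF 1 ef(3)] ef(4,5) by (auto simp: \<gamma>'_def)
    next
      case 2
      then show ?thesis using seg_arc[OF F'[OF 2(2)] 2(1)] ef(4,5) by (simp add: \<gamma>'_def)
    next
      case 3
      then show ?thesis using seg_arc[OF F'[OF 3(1)] 3(3)] ef(4,5) by (simp add: \<gamma>'_def)
    next
      case 4
      have "{x e, y e} \<noteq> {x f, y f}"
        using xy[OF 4(1)] xy[OF 4(3)] ef(3) by metis
      then show ?thesis using seg_seg[OF F'[OF 4(1)] F'[OF 4(3)]] ef(4,5) 4 by (simp add: \<gamma>'_def)
    qed
  qed
  have "drawing (verts G \<union> N, edges G \<union> F) p \<gamma>'"
    unfolding drawing_def fst_conv snd_conv
  proof (intro conjI ballI impI)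
    show "inj_on p (verts G \<union> N)" by (rule inj)
    fix e assume e: "e \<in> edges G \<union> F"
    show arc: "arc (\<gamma>' e)"
    proof (cases "e \<in> edges G")
      case False
      then have "p (x e) \<noteq> p (y e)"
        using xy[of e] e inj by (auto simp: inj_on_def)
      then show ?thesis using False by (simp add: \<gamma>'_def)
    qed (use dG(2) in \<open>simp add: \<gamma>'_def\<close>)
    show ends: "{pathstart (\<gamma>' e), pathfinish (\<gamma>' e)} = p ` e"
    proof (cases "e \<in> edges G")
      case False
      then have "p ` e = {p (x e), p (y e)}"
        using xy[of e] e by (metis Un_iff image_empty image_insert)
      then show ?thesis using False by (simp add: \<gamma>'_def)
    qed (use dG(3) in \<open>simp add: \<gamma>'_def\<close>)
    show "path_image (\<gamma>' e) \<inter> p ` (verts G \<union> N) = p ` e"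
    proof (intro equalityI subsetI)
      fix z assume z: "z \<in> path_image (\<gamma>' e) \<inter> p ` (verts G \<union> N)"
      show "z \<in> p ` e"
      proof (cases "e \<in> edges G")
        case True
        then show ?thesis using old[OF True, of z] z by (simp add: \<gamma>'_def)
      next
        case False
        then have "e \<in> F" using e by blast
        obtain v where v: "v \<in> verts G \<union> N" "z = p v" using z by blast
        then have "v = x e \<or> v = y e"
          using seg_vert[OF F'[OF \<open>e \<in> F\<close>] v(1)] z False by (simp add: \<gamma>'_def)
        moreover have "x e \<in> e" "y e \<in> e"
          using xy[OF \<open>e \<in> F\<close>] by (metis insertCI)+
        ultimately show ?thesis using v(2) by blast
      qed
    next
      fix z assume z: "z \<in> p ` e"
      then have "z \<in> path_image (\<gamma>' e)"
        using ends by (metis insertE pathfinish_in_path_image pathstart_in_path_image singletonD)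
      moreover have "e \<subseteq> verts G \<union> N"
        using e eV F by blast
      ultimately show "z \<in> path_image (\<gamma>' e) \<inter> p ` (verts G \<union> N)"
        using z by blast
    qed
    fix f assume f: "f \<in> edges G \<union> F" "e \<noteq> f"
    show "path_image (\<gamma>' e) \<inter> path_image (\<gamma>' f) \<subseteq> p ` (verts G \<union> N)"
      using cross[OF e f] by blast
  qed
  then show ?thesis
    using planar_iff_drawing by blast
qed

text \<open>The join of an edge \<open>{0, 1}\<close> with the path \<open>2, \<dots>, n\<close>.\<close>

definition book_pairs :: "nat \<Rightarrow> (nat \<times> nat) set" where
  "book_pairs n = {(0, i) | i. 1 \<le> i \<and> i \<le> n} \<union> {(1, i) | i. 2 \<le> i \<and> i \<le> n} \<union> {(i, Suc i) | i. 2 \<le> i \<and> i < n}"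

lemma book_pairs_less: "(i, j) \<in> book_pairs n \<Longrightarrow> i < j \<and> j \<le> n"
  by (auto simp: book_pairs_def)

lemma finite_book_pairs: "finite (book_pairs n)"
  by (rule finite_subset[of _ "{..n} \<times> {..n}"]) (auto simp: book_pairs_def)

text \<open>The case \<open>n = 1\<close> is special: only the edge \<open>{0, 1}\<close> is left,
  where \<open>3 * n - 3\<close> would give 0.\<close>

lemma card_book_pairs: "1 \<le> n \<Longrightarrow> card (book_pairs n) = (if n = 1 then 1 else 3 * n - 3)"
proof -
  assume n: "1 \<le> n"
  define A where "A = Pair (0::nat) ` {1..n}"
  define B where "B = Pair (1::nat) ` {2..n}"
  define C where "C = (\<lambda>i. (i, Suc i)) ` {2..<n}"
  have "book_pairs n = A \<union> (B \<union> C)"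
    by (auto simp: book_pairs_def A_def B_def C_def)
  moreover have "A \<inter> (B \<union> C) = {}" "B \<inter> C = {}"
    by (auto simp: A_def B_def C_def)
  ultimately have "card (book_pairs n) = card A + (card B + card C)"
    by (simp add: card_Un_disjoint A_def B_def C_def)
  moreover have "card A = n" "card B = n - 1" "card C = n - 2"
    by (simp_all add: A_def B_def C_def card_image inj_on_def)
  ultimately show ?thesis using n by auto
qed

text \<open>A straight-line drawing: the edge \<open>{0, 1}\<close> runs from 0 to 2 on the real
  axis, and the path climbs the line \<open>Re = 1\<close> above it. Vertex 2 starts at height
  \<open>\<delta>\<close>, not 0, to stay off that edge; a small \<open>\<delta>\<close> flattens
  the picture to fit a given sector.\<close>

definition book_pos :: "real \<Rightarrow> nat \<Rightarrow> complex" where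
  "book_pos \<delta> i = (if i = 0 then 0 else if i = 1 then 2 else Complex 1 (\<delta> * real (i - 1)))"

lemma inj_book_pos: "0 < \<delta> \<Longrightarrow> inj (book_pos \<delta>)"
  by (auto simp: inj_def book_pos_def complex_eq_iff split: if_splits)

lemma book_segment_cases:
  assumes "(i, j) \<in> book_pairs n" "0 < \<delta>" "z \<in> closed_segment (book_pos \<delta> i) (book_pos \<delta> j)"
  obtains
    "i = 0" "1 \<le> j" "j \<le> n" "Im z = \<delta> * real (j - 1) * Re z" "0 \<le> Re z" "Re z \<le> (if j = 1 then 2 else 1)"
  | "i = 1" "2 \<le> j" "j \<le> n" "Im z = \<delta> * real (j - 1) * (2 - Re z)" "1 \<le> Re z" "Re z \<le> 2"
  | "2 \<le> i" "j = Suc i" "j \<le> n" "Re z = 1" "\<delta> * real (i - 1) \<le> Im z" "Im z \<le> \<delta> * real i"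
proof -
  obtain t where t: "0 \<le> t" "t \<le> 1" "z = (1 - t) *\<^sub>R book_pos \<delta> i + t *\<^sub>R book_pos \<delta> j"
    using assms(3) by (auto simp: in_segment)
  have z: "Re z = (1 - t) * Re (book_pos \<delta> i) + t * Re (book_pos \<delta> j)"
     "Im z = (1 - t) * Im (book_pos \<delta> i) + t * Im (book_pos \<delta> j)"
    by (simp_all add: t(3))
  consider "i = 0" "1 \<le> j" "j \<le> n" | "i = 1" "2 \<le> j" "j \<le> n" | "2 \<le> i" "j = Suc i" "i < n"
    using assms(1) by (auto simp: book_pairs_def)
  then show thesis
  proof cases
    case 1
    then show ?thesis
      using z t(1,2) by (intro that(1)) (auto simp: book_pos_def)
  next
    case 2
    then show ?thesis
    proof (intro that(2))
      have *: "t = 2 - Re z"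
        using z(1) 2 by (simp add: book_pos_def)
      show "Im z = \<delta> * real (j - 1) * (2 - Re z)"
        using z(2) 2 by (simp add: book_pos_def flip: *)
      show "1 \<le> Re z" "Re z \<le> 2"
        using * t(1,2) by simp_all
    qed (use 2 in simp_all)
  next
    case 3
    have "Im z = \<delta> * real (i - 1) + t * \<delta>"
      using z(2) 3 by (simp add: book_pos_def of_nat_diff algebra_simps)
    moreover have "0 \<le> t * \<delta>" "t * \<delta> \<le> 1 * \<delta>"
      using t assms(2) by (auto intro: mult_right_mono)
    moreover have "\<delta> * real i = \<delta> * real (i - 1) + \<delta>"
      using 3 by (simp add: of_nat_diff algebra_simps)
    ultimately show ?thesis
      using z(1) 3 by (intro that(3)) (auto simp: book_pos_def)
  qed
qed

lemma book_segment_vertex: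
  assumes "(i, j) \<in> book_pairs n" "0 < \<delta>"
    and "book_pos \<delta> l \<in> closed_segment (book_pos \<delta> i) (book_pos \<delta> j)"
  shows "l = i \<or> l = j"
  using assms
proof (cases rule: book_segment_cases)
  case 1
  then show ?thesis
    using assms(2) by (auto simp: book_pos_def split: if_splits)
next
  case 2
  then show ?thesis
    using assms(2) by (auto simp: book_pos_def split: if_splits)
next
  case 3
  have "l \<noteq> 0" "l \<noteq> 1"
    using 3(4) by (metis book_pos_def zero_complex.sel(1) zero_neq_one, 
      metis book_pos_def complex_Re_numeral numeral_One numeral_eq_iff semiring_norm(85) zero_neq_one)
  then have "\<delta> * real (i - 1) \<le> \<delta> * real (l - 1)" "\<delta> * real (l - 1) \<le> \<delta> * real i"
    using 3(5,6) by (simp_all add: book_pos_def)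
  then have "i - 1 \<le> l - 1" "l - 1 \<le> i"
    using assms(2) by simp_all
  then show ?thesis
    using 3 \<open>l \<noteq> 0\<close> by linarith
qed

lemma book_segments_meet:
  assumes ij: "(i, j) \<in> book_pairs n" and ij': "(i', j') \<in> book_pairs n" and "(i, j) \<noteq> (i', j')" "0 < \<delta>"
    and z: "z \<in> closed_segment (book_pos \<delta> i) (book_pos \<delta> j)"
    and z': "z \<in> closed_segment (book_pos \<delta> i') (book_pos \<delta> j')"
  shows "z \<in> book_pos \<delta> ` {..n}"
proof -
  have n: "1 \<le> n" using book_pairs_less[OF ij] by linarith
  have vertices: "z \<in> book_pos \<delta> ` {..n}" if "z = 0 \<or> z = 2 \<or> (\<exists>l. 2 \<le> l \<and> l \<le> n \<and> z = Complex 1 (\<delta> * real (l - 1)))"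
  proof -
    have "book_pos \<delta> 0 = 0" "book_pos \<delta> 1 = 2" "2 \<le> l \<Longrightarrow> book_pos \<delta> l = Complex 1 (\<delta> * real (l - 1))" for l
      by (simp_all add: book_pos_def)
    then show ?thesis using that n by (metis atMost_iff image_eqI le0)
  qed
  \<comment> \<open>\<open>min i 2\<close> tells apart segments from vertex 0, segments from vertex
    1 and path segments. By symmetry the first segment may be assumed of the earlier kind.\<close>
  have main: "z \<in> book_pos \<delta> ` {..n}" if "(i, j) \<in> book_pairs n" "(i', j') \<in> book_pairs n" "(i, j) \<noteq> (i', j')"
    "z \<in> closed_segment (book_pos \<delta> i) (book_pos \<delta> j)" "z \<in> closed_segment (book_pos \<delta> i') (book_pos \<delta> j')"
    "min i 2 \<le> min i' 2" for i j i' j'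
    using that(1) assms(4) that(4)
  proof (cases rule: book_segment_cases)
    case 1
    show ?thesis
      using that(2) assms(4) that(5)
    proof (cases rule: book_segment_cases)
      case A: 1
      then have "j \<noteq> j'" using 1(1) A(1) that(3) by blast
      moreover have "\<delta> * real (j - 1) * Re z = \<delta> * real (j' - 1) * Re z" using 1(4) A(4) by metis
      ultimately have "Re z = 0" using assms(4) 1(2) A(2) by auto
      then have "z = 0" using 1 by (simp add: complex_eq_iff)
      then show ?thesis using vertices by blast
    next
      case A: 2
      show ?thesis
      proof (cases "j = 1")
        case True
        then have "Im z = 0" using 1 by simp
        then have "Re z = 2" using A assms(4) by simp
        then have "z = 2" using \<open>Im z = 0\<close> by (simp add: complex_eq_iff)
        then show ?thesis using vertices by blast
      next
        case False
        then have "Re z = 1" "2 \<le> j" using 1 A by auto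
        then have "z = Complex 1 (\<delta> * real (j - 1))" using 1 by (simp add: complex_eq_iff)
        then show ?thesis using vertices 1(3) \<open>2 \<le> j\<close> by blast
      qed
    next
      case A: 3
      have "0 < \<delta> * real (i' - 1)" using A assms(4) by simp
      then have "j \<noteq> 1" using A 1 by auto
      then have "2 \<le> j" "z = Complex 1 (\<delta> * real (j - 1))" using 1 A by (auto simp: complex_eq_iff)
      then show ?thesis using vertices 1(3) by blast
    qed
  next
    case 2
    show ?thesis
      using that(2) assms(4) that(5)
    proof (cases rule: book_segment_cases)
      case A: 1
      then show ?thesis using 2 that(6) by simp
    next
      case A: 2
      then have "j \<noteq> j'" using 2(1) A(1) that(3) by blast
      moreover have "\<delta> * real (j - 1) * (2 - Re z) = \<delta> * real (j' - 1) * (2 - Re z)" using 2(4) A(4) by metis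
      ultimately have "Re z = 2" using assms(4) 2(2) A(2) by auto
      then have "z = 2" using 2 by (simp add: complex_eq_iff)
      then show ?thesis using vertices by blast
    next
      case A: 3
      then have "z = Complex 1 (\<delta> * real (j - 1))" using 2 by (simp add: complex_eq_iff)
      then show ?thesis using vertices 2(2,3) by blast
    qed
  next
    case 3
    show ?thesis
      using that(2) assms(4) that(5)
    proof (cases rule: book_segment_cases)
      case A: 3
      have "i \<noteq> i'" using 3 A that(3) by auto
      have "\<delta> * real (i - 1) \<le> \<delta> * real i'" "\<delta> * real (i' - 1) \<le> \<delta> * real i"
        using 3 A by linarith+
      then have "i - 1 \<le> i'" "i' - 1 \<le> i"
        using assms(4) by simp_all
      then consider "i' = Suc i" | "i = Suc i'" using \<open>i \<noteq> i'\<close> 3(1) A(1) by linarith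
      then show ?thesis
      proof cases
        case B: 1
        then have "z = Complex 1 (\<delta> * real (i' - 1))" using 3 A by (simp add: complex_eq_iff)
        then show ?thesis using vertices A(1-3) by (metis Suc_leD)
      next
        case B: 2
        then have "z = Complex 1 (\<delta> * real (i - 1))" using 3 A by (simp add: complex_eq_iff)
        then show ?thesis using vertices 3(1-3) by (metis Suc_leD)
      qed
    qed (use 3 that(6) in auto)
  qed
  show ?thesis
    using main[OF ij ij' assms(3) z z'] main[OF ij' ij assms(3)[symmetric] z' z] by linarith
qed

lemma book_segment_sector:
  assumes "(i, j) \<in> book_pairs n" "0 < \<delta>" "z \<in> closed_segment (book_pos \<delta> i) (book_pos \<delta> j)"
  shows "z = 0 \<or> 0 < Re z \<and> Re z \<le> 2 \<and> 0 \<le> Im z \<and> Im z \<le> \<delta> * real n * Re z"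
  using assms
proof (cases rule: book_segment_cases)
  case 1
  have "\<delta> * real (j - 1) * Re z \<le> \<delta> * real n * Re z"
    using 1 assms(2) by (intro mult_right_mono mult_left_mono) auto
  then show ?thesis
    using 1 assms(2) by (cases "Re z = 0") (auto simp: complex_eq_iff split: if_splits)
next
  case 2
  \<comment> \<open>On the right half \<open>2 - Re z <= 1 <= Re z\<close>, so these segments lie
    below the same line through 0.\<close>
  have "\<delta> * real (j - 1) * (2 - Re z) \<le> \<delta> * real n * Re z"
    using 2 assms(2) by (intro mult_mono mult_left_mono) auto
  moreover have "0 \<le> \<delta> * real (j - 1) * (2 - Re z)"
    using 2 assms(2) by (intro mult_nonneg_nonneg) auto
  ultimately show ?thesis
    using 2 by simp
next
  case 3
  have "\<delta> * real i \<le> \<delta> * real n"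
    using 3 assms(2) by (intro mult_left_mono) auto
  moreover have "0 \<le> \<delta> * real (i - 1)"
    using assms(2) by simp
  ultimately show ?thesis
    using 3 by simp
qed

definition book_edges :: "(nat \<Rightarrow> 'a) \<Rightarrow> nat \<Rightarrow> 'a set set" where
  "book_edges r n = (\<lambda>(i, j). {r i, r j}) ` book_pairs n"

text \<open>The book is flattened into the free sector at \<open>r 0\<close>. It meets the old
  drawing only in the origin, which is the position of \<open>r 0\<close> in both.\<close>

lemma planar_glue_book:
  assumes G: "simple_graph G" "planar G" and r0: "r 0 \<in> verts G" and inj: "inj_on r {..n}"
    and new: "r ` {1..n} \<inter> verts G = {}"
  shows "planar (verts G \<union> r ` {1..n}, edges G \<union> book_edges r n)"
proof -
  obtain p \<gamma> \<sigma> where d: "drawing G p \<gamma>" and p0: "p (r 0) = 0" and \<sigma>: "\<sigma> > 0" and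
    sector: "\<And>x. x \<in> p ` verts G \<union> (\<Union>e\<in>edges G. path_image (\<gamma> e)) \<Longrightarrow> 0 < Re x \<Longrightarrow> Re x \<le> 2 \<Longrightarrow>
      0 \<le> Im x \<Longrightarrow> \<sigma> * Re x < Im x"
    using planar_free_sector[OF G r0] by blast
  \<comment> \<open>With \<open>Suc n\<close> the denominator never vanishes, and
    \<open>\<delta> * n <= \<sigma>\<close> still holds.\<close>
  define \<delta> where "\<delta> = \<sigma> / real (Suc n)"
  have \<delta>: "0 < \<delta>" using \<sigma> by (simp add: \<delta>_def)
  have "\<delta> * real n \<le> \<sigma>"
    using \<sigma> by (simp add: \<delta>_def field_simps)
  then have \<delta>n: "\<delta> * real n * t \<le> \<sigma> * t" if "0 \<le> t" for t
    using that by (intro mult_right_mono)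
  define q where "q v = (if v \<in> verts G then p v else book_pos \<delta> (the_inv_into {..n} r v))" for v
  have qG: "q v = p v" if "v \<in> verts G" for v
    using that by (simp add: q_def)
  have qr: "q (r i) = book_pos \<delta> i" if "i \<le> n" for i
  proof (cases "i = 0")
    case True
    then show ?thesis using r0 p0 by (simp add: q_def book_pos_def)
  next
    case False
    then have "r i \<in> r ` {1..n}" using that by auto
    then have "r i \<notin> verts G" using new by blast
    then show ?thesis using the_inv_into_f_f[OF inj, of i] that by (simp add: q_def)
  qed
  have book_sector: "z = 0" if "(i, j) \<in> book_pairs n" "z \<in> closed_segment (book_pos \<delta> i) (book_pos \<delta> j)"
    "z \<in> p ` verts G \<union> (\<Union>e\<in>edges G. path_image (\<gamma> e))" for i j z
  proof (rule ccontr)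
    assume "z \<noteq> 0"
    then have z: "0 < Re z" "Re z \<le> 2" "0 \<le> Im z" "Im z \<le> \<delta> * real n * Re z"
      using book_segment_sector[OF that(1) \<delta> that(2)] by auto
    then show False
      using sector[OF that(3) z(1-3)] \<delta>n[of "Re z"] z(1,4) by linarith
  qed
  have book_old: "book_pos \<delta> i \<notin> p ` verts G \<union> (\<Union>e\<in>edges G. path_image (\<gamma> e))" if "1 \<le> i" "i \<le> n" for i
  proof
    assume *: "book_pos \<delta> i \<in> p ` verts G \<union> (\<Union>e\<in>edges G. path_image (\<gamma> e))"
    have "(0, i) \<in> book_pairs n" using that by (auto simp: book_pairs_def)
    then have "book_pos \<delta> i = 0" using book_sector[of 0 i] * by blast
    then show False using that by (auto simp: book_pos_def complex_eq_iff split: if_splits)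
  qed
  have V: "verts G \<union> r ` {1..n} = verts G \<union> r ` {..n}"
    using r0 by (auto simp: image_iff) (metis One_nat_def Suc_leI atLeastAtMost_iff neq0_conv)
  have pair: "\<exists>i j. (i, j) \<in> book_pairs n \<and> e = {r i, r j}" if "e \<in> book_edges r n" for e
    using that by (auto simp: book_edges_def)
  have le: "i \<le> n" "j \<le> n" "i \<noteq> j" if "(i, j) \<in> book_pairs n" for i j
    using book_pairs_less[OF that] by auto
  have seg: "\<exists>i j. (i, j) \<in> book_pairs n \<and> {x, y} = {r i, r j} \<and>
      closed_segment (q x) (q y) = closed_segment (book_pos \<delta> i) (book_pos \<delta> j)" if "{x, y} \<in> book_edges r n" for x y
  proof -
    obtain i j where ij: "(i, j) \<in> book_pairs n" "{x, y} = {r i, r j}"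
      using pair[OF \<open>{x, y} \<in> _\<close>] by blast
    then have "x = r i \<and> y = r j \<or> x = r j \<and> y = r i"
      by (simp add: doubleton_eq_iff)
    then have "closed_segment (q x) (q y) = closed_segment (book_pos \<delta> i) (book_pos \<delta> j)"
      using qr le[OF ij(1)] closed_segment_commute by metis
    then show ?thesis using ij by blast
  qed
  show ?thesis
  proof (rule drawing_add_segments[where p = q and \<gamma> = \<gamma>])
    show "drawing G q \<gamma>"
    proof -
      have im: "q ` S = p ` S" if "S \<subseteq> verts G" for S
        using that qG by (auto simp: image_iff subset_iff)
      have "e \<subseteq> verts G" if "e \<in> edges G" for e
        using G(1) that by (simp add: simple_graph_def)
      then show ?thesis
        using d qG unfolding drawing_def by (simp add: im inj_on_def)
    qed
    show "inj_on q (verts G \<union> r ` {1..n})"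
    proof -
      have "q x \<noteq> q y" if xy: "x \<in> verts G" "y \<in> r ` {..n}" "x \<noteq> y" "y \<notin> verts G" for x y
      proof -
        obtain i where i: "y = r i" "i \<le> n" using xy(2) by auto
        then have "1 \<le> i" using xy(4) r0 by (cases i) auto
        then show ?thesis using book_old[of i] i qr[of i] qG[OF xy(1)] xy(1) by (metis UnI1 imageI)
      qed
      moreover have "inj_on q (verts G)"
        using drawingD(1)[OF d] qG by (simp add: inj_on_def)
      moreover have "inj_on q (r ` {..n})"
        using qr inj_book_pos[OF \<delta>] by (auto simp: inj_on_def inj_def)
      ultimately show ?thesis
        unfolding V inj_on_def by (metis UnE)
    qed
    show "e \<subseteq> verts G \<union> r ` {1..n} \<and> card e = 2" if e: "e \<in> book_edges r n" for e
    proof -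
      obtain i j where ij: "(i, j) \<in> book_pairs n" "e = {r i, r j}"
        using pair[OF e] by blast
      then show ?thesis
        unfolding V using le[OF ij(1)] inj_on_eq_iff[OF inj, of i j] by auto
    qed
    show "q v \<notin> path_image (\<gamma> e)" if ev: "e \<in> edges G" "v \<in> r ` {1..n}" for e v
    proof -
      obtain i where "1 \<le> i" "i \<le> n" "v = r i" using ev(2) by auto
      then show ?thesis using book_old[of i] qr[of i] ev(1) by auto
    qed
    have vert: "z \<in> q ` (verts G \<union> r ` {1..n})" if z: "z \<in> book_pos \<delta> ` {..n}" for z
    proof -
      obtain l where "l \<le> n" "z = book_pos \<delta> l" using z by auto
      then have "z = q (r l)" "r l \<in> verts G \<union> r ` {..n}" using qr by auto
      then show ?thesis unfolding V by blast
    qed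
    show "v = x \<or> v = y" if xy: "{x, y} \<in> book_edges r n" and v: "v \<in> verts G \<union> r ` {1..n}"
      "q v \<in> closed_segment (q x) (q y)" for x y v
    proof -
      obtain i j where ij: "(i, j) \<in> book_pairs n" "{x, y} = {r i, r j}"
        and s: "closed_segment (q x) (q y) = closed_segment (book_pos \<delta> i) (book_pos \<delta> j)"
        using seg[OF xy] by blast
      \<comment> \<open>An old vertex on a segment of the book must be at the origin and is
        therefore \<open>r 0\<close>.\<close>
      have "\<exists>l\<le>n. v = r l"
      proof (cases "v \<in> verts G")
        case True
        then have "q v = 0"
          using book_sector[OF ij(1), of "q v"] v(2) s qG by auto
        then have "p v = p (r 0)" using qG True p0 by simp
        then have "v = r 0" using drawingD(1)[OF d] True r0 by (simp add: inj_on_def)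
        then show ?thesis by blast
      qed (use v(1) in auto)
      then obtain l where l: "l \<le> n" "v = r l" by blast
      then have "l = i \<or> l = j"
        using book_segment_vertex[OF ij(1) \<delta>, of l] v(2) s qr by simp
      then have "v \<in> {x, y}" using ij(2) l(2) by auto
      then show ?thesis by simp
    qed
    show "z \<in> q ` (verts G \<union> r ` {1..n})"
      if xy: "{x, y} \<in> book_edges r n" "{x', y'} \<in> book_edges r n" "{x, y} \<noteq> {x', y'}"
        "z \<in> closed_segment (q x) (q y)" "z \<in> closed_segment (q x') (q y')" for x y x' y' z
    proof -
      obtain i j where ij: "(i, j) \<in> book_pairs n" "{x, y} = {r i, r j}"
        and s: "closed_segment (q x) (q y) = closed_segment (book_pos \<delta> i) (book_pos \<delta> j)"
        using seg[OF xy(1)] by blast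
      obtain i' j' where ij': "(i', j') \<in> book_pairs n" "{x', y'} = {r i', r j'}"
        and s': "closed_segment (q x') (q y') = closed_segment (book_pos \<delta> i') (book_pos \<delta> j')"
        using seg[OF xy(2)] by blast
      have "(i, j) \<noteq> (i', j')" using xy(3) ij(2) ij'(2) by auto
      then show ?thesis
        using vert book_segments_meet[OF ij(1) ij'(1) _ \<delta>] xy(4,5) s s' by simp
    qed
    show "z \<in> q ` (verts G \<union> r ` {1..n})"
      if xy: "{x, y} \<in> book_edges r n" "e \<in> edges G" "z \<in> closed_segment (q x) (q y)"
        "z \<in> path_image (\<gamma> e)" for x y e z
    proof -
      obtain i j where ij: "(i, j) \<in> book_pairs n"
        and s: "closed_segment (q x) (q y) = closed_segment (book_pos \<delta> i) (book_pos \<delta> j)"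
        using seg[OF xy(1)] by blast
      have "z = 0" using book_sector[OF ij, of z] xy s by auto
      then have "z = q (r 0)" using qG r0 p0 by simp
      then show ?thesis using r0 by blast
    qed
  qed (rule G(1))
qed

section \<open>Theta graphs\<close>

text \<open>The cycle \<open>c\<close> is kept apart from the positions \<open>i\<close>,
  \<open>j\<close> of the chord, so that one cycle can be combined with any other chord;
  \<open>theta_edge_bound\<close> lives on this.\<close>

definition theta_at :: "nat \<Rightarrow> 'a graph \<Rightarrow> (nat \<Rightarrow> 'a) \<Rightarrow> nat \<Rightarrow> nat \<Rightarrow> bool" where
  "theta_at k G c i j \<longleftrightarrow> inj_on c {..<k} \<and> c ` {..<k} \<subseteq> verts G \<and>
     (\<forall>t<k. {c t, c (Suc t mod k)} \<in> edges G) \<and>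
     i < k \<and> j < k \<and> i \<noteq> j \<and> j \<noteq> Suc i mod k \<and> i \<noteq> Suc j mod k \<and> {c i, c j} \<in> edges G"

definition has_theta :: "nat \<Rightarrow> 'a graph \<Rightarrow> bool" where
  "has_theta k G \<longleftrightarrow> (\<exists>c i j. theta_at k G c i j)"

definition cycle_edges :: "nat \<Rightarrow> nat set set" where
  "cycle_edges k = (\<lambda>t. {t, Suc t mod k}) ` {..<k}"

lemma Suc_mod_less: "t < k \<Longrightarrow> Suc t mod k < k"
  by (cases k) auto

lemma standard_Theta:
  assumes "3 \<le> k" "i < k" "j < k" "i \<noteq> j" "j \<noteq> Suc i mod k" "i \<noteq> Suc j mod k"
  shows "({..<k}, insert {i, j} (cycle_edges k)) \<in> Theta k"
proof -
  have "is_cycle k ({..<k}, cycle_edges k)"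
    unfolding is_cycle_def cycle_edges_def using assms(1) by (auto intro!: exI[of _ id])
  moreover have "{i, j} \<notin> cycle_edges k"
    using assms by (auto simp: cycle_edges_def doubleton_eq_iff)
  ultimately show ?thesis
    unfolding Theta_def using assms(2-4)
    by (intro CollectI exI[of _ "({..<k}, cycle_edges k)"] exI[of _ i] exI[of _ j]) simp
qed

lemma family_free_Theta_iff:
  assumes "3 \<le> k"
  shows "family_free (Theta k) G \<longleftrightarrow> \<not> has_theta k G"
proof
  assume free: "family_free (Theta k) G"
  show "\<not> has_theta k G"
  proof
    assume "has_theta k G"
    then obtain c i j where th: "theta_at k G c i j"
      by (auto simp: has_theta_def)
    then have "({..<k}, insert {i, j} (cycle_edges k)) \<in> Theta k"
      using assms by (intro standard_Theta) (auto simp: theta_at_def)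
    moreover have "contains G ({..<k}, insert {i, j} (cycle_edges k))"
      unfolding contains_def using th by (intro exI[of _ c]) (auto simp: theta_at_def cycle_edges_def)
    ultimately show False
      using free by (auto simp: family_free_def)
  qed
next
  assume no: "\<not> has_theta k G"
  show "family_free (Theta k) G"
    unfolding family_free_def
  proof (intro ballI notI)
    fix H assume "H \<in> Theta k" "contains G H"
    then obtain C u v where C: "is_cycle k C" "u \<in> verts C" "v \<in> verts C" "u \<noteq> v" "{u, v} \<notin> edges C"
      and H: "H = (verts C, insert {u, v} (edges C))"
      by (auto simp: Theta_def)
    obtain f where f: "inj_on f (verts C)" "f ` verts C \<subseteq> verts G" "\<And>e. e \<in> insert {u, v} (edges C) \<Longrightarrow> f ` e \<in> edges G"
      using \<open>contains G H\<close> unfolding contains_def H fst_conv snd_conv by blast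
    obtain c where c: "bij_betw c {..<k} (verts C)" "edges C = (\<lambda>i. {c i, c (Suc i mod k)}) ` {..<k}"
      using C(1) by (auto simp: is_cycle_def)
    have cv: "c ` {..<k} = verts C" using c(1) by (simp add: bij_betw_def)
    obtain i j where ij: "i < k" "u = c i" "j < k" "v = c j"
      using C(2,3) unfolding cv[symmetric] by blast
    have "theta_at k G (f \<circ> c) i j"
      unfolding theta_at_def
    proof (intro conjI allI impI)
      show "inj_on (f \<circ> c) {..<k}"
        using c(1) f(1) by (auto simp: bij_betw_def intro: comp_inj_on)
      show "(f \<circ> c) ` {..<k} \<subseteq> verts G"
        using f(2) cv by auto
      show "{(f \<circ> c) t, (f \<circ> c) (Suc t mod k)} \<in> edges G" if "t < k" for t
        using f(3)[of "{c t, c (Suc t mod k)}"] c(2) that by auto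
      show "{(f \<circ> c) i, (f \<circ> c) j} \<in> edges G"
        using f(3)[of "{u, v}"] ij by simp
      show "i \<noteq> j" using C(4) ij by auto
      show "j \<noteq> Suc i mod k" using C(5) c(2) ij by auto
      show "i \<noteq> Suc j mod k" using C(5) c(2) ij by (auto simp: insert_commute)
    qed (use ij in auto)
    then show False using no by (auto simp: has_theta_def)
  qed
qed

lemma Theta_plus_free_if_Theta_free:
  assumes "family_free (Theta k) G"
  shows "family_free (Theta_plus k) G"
  unfolding family_free_def
proof (intro ballI notI)
  fix H' assume "H' \<in> Theta_plus k" "contains G H'"
  then obtain H v w where H: "H \<in> Theta k" and H': "H' = (insert w (verts H), insert {v, w} (edges H))"
    by (auto simp: Theta_plus_def pendant_extensions_def)
  obtain f where f: "inj_on f (verts H')" "f ` verts H' \<subseteq> verts G" "\<forall>e\<in>edges H'. f ` e \<in> edges G"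
    using \<open>contains G H'\<close> unfolding contains_def by blast
  have "inj_on f (verts H)" "f ` verts H \<subseteq> verts G" "\<forall>e\<in>edges H. f ` e \<in> edges G"
    using f by (auto simp: H')
  then have "contains G H"
    unfolding contains_def by blast
  with H assms show False
    by (auto simp: family_free_def)
qed

lemma degree_theta:
  assumes "3 \<le> k" "l < k" "l \<noteq> i" "l \<noteq> j"
  shows "degree ({..<k}, insert {i, j} (cycle_edges k)) l = 2"
proof -
  \<comment> \<open>The cyclic predecessor of \<open>l\<close>, with the wrap-around at 0 made
    explicit.\<close>
  define l' where "l' = (if l = 0 then k - 1 else l - 1)"
  have l': "l' < k" "Suc l' mod k = l"
    using assms by (auto simp: l'_def)
  have pred: "t = l'" if "t < k" "Suc t mod k = l" for t
    using that assms(1) by (auto simp: l'_def mod_Suc split: if_splits)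
  have "Suc l mod k \<noteq> l'"
    using assms(1,2) by (auto simp: l'_def mod_Suc)
  have "Suc l mod k \<noteq> l"
    using assms(1,2) by (auto simp: mod_Suc)
  have "{e \<in> insert {i, j} (cycle_edges k). l \<in> e} = {{l, Suc l mod k}, {l', l}}"
  proof (intro equalityI subsetI)
    fix e assume "e \<in> {e \<in> insert {i, j} (cycle_edges k). l \<in> e}"
    then obtain t where "t < k" "e = {t, Suc t mod k}" "l = t \<or> l = Suc t mod k"
      using assms(3,4) by (auto simp: cycle_edges_def)
    then show "e \<in> {{l, Suc l mod k}, {l', l}}"
      using pred by auto
  next
    fix e assume "e \<in> {{l, Suc l mod k}, {l', l}}"
    then show "e \<in> {e \<in> insert {i, j} (cycle_edges k). l \<in> e}"
      using l' assms(2) by (auto simp: cycle_edges_def)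
  qed
  moreover have "{l, Suc l mod k} \<noteq> {l', l}"
    using \<open>Suc l mod k \<noteq> l'\<close> \<open>Suc l mod k \<noteq> l\<close> by (auto simp: doubleton_eq_iff)
  ultimately show ?thesis
    by (simp add: degree_def)
qed

text \<open>Off the chord a Theta graph has degree two, so an edge from there to a new vertex would
  complete a member of \<open>Theta_plus k\<close>. In the pattern on \<open>{..<k}\<close> the
  pendant vertex is \<open>k\<close>, which is sent to \<open>w\<close>.\<close>

lemma Theta_plus_free_no_pendant:
  assumes k: "3 \<le> k" and free: "family_free (Theta_plus k) G" and th: "theta_at k G c i j"
    and l: "l < k" "l \<noteq> i" "l \<noteq> j" and w: "w \<in> verts G" "w \<notin> c ` {..<k}"
  shows "{c l, w} \<notin> edges G"
proof
  assume edge: "{c l, w} \<in> edges G"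
  define H where "H = ({..<k}, insert {i, j} (cycle_edges k))"
  have "H \<in> Theta k"
    unfolding H_def using k th by (intro standard_Theta) (auto simp: theta_at_def)
  moreover have "(insert k (verts H), insert {l, k} (edges H)) \<in> pendant_extensions H"
    unfolding pendant_extensions_def using degree_theta[OF k l] l(1)
    by (intro CollectI exI[of _ l] exI[of _ k]) (simp add: H_def)
  ultimately have "(insert k (verts H), insert {l, k} (edges H)) \<in> Theta_plus k"
    by (auto simp: Theta_plus_def)
  moreover have "contains G (insert k (verts H), insert {l, k} (edges H))"
    unfolding contains_def
  proof (intro exI[of _ "c(k := w)"] conjI ballI)
    have less: "(c(k := w)) t = c t" if "t < k" for t
      using that by simp
    show "inj_on (c(k := w)) (verts (insert k (verts H), insert {l, k} (edges H)))"
      using th w(2) by (auto simp: H_def theta_at_def inj_on_def)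
    show "(c(k := w)) ` verts (insert k (verts H), insert {l, k} (edges H)) \<subseteq> verts G"
      using th w(1) by (auto simp: H_def theta_at_def)
    fix e assume "e \<in> edges (insert k (verts H), insert {l, k} (edges H))"
    then consider "e = {l, k}" | "e = {i, j}" | t where "t < k" "e = {t, Suc t mod k}"
      by (auto simp: H_def cycle_edges_def)
    then show "(c(k := w)) ` e \<in> edges G"
    proof cases
      case 1
      then show ?thesis using edge l(1) by simp
    next
      case 2
      then show ?thesis using th by (simp add: theta_at_def)
    next
      case 3
      then have "(c(k := w)) ` e = {c t, c (Suc t mod k)}"
        using less Suc_mod_less[OF 3(1)] by (simp del: fun_upd_apply)
      then show ?thesis using th 3(1) by (simp add: theta_at_def)
    qed
  qed
  ultimately show False
    using free by (auto simp: family_free_def)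
qed

section \<open>Edges inside the vertex set of a Theta graph\<close>

definition attached :: "'a graph \<Rightarrow> 'a set \<Rightarrow> 'a set" where
  "attached G S = {v \<in> S. \<exists>w\<in>verts G - S. {v, w} \<in> edges G}"

lemma attached_subset_chord:
  assumes "3 \<le> k" "family_free (Theta_plus k) G" "theta_at k G c i j"
  shows "attached G (c ` {..<k}) \<subseteq> {c i, c j}"
proof
  fix v assume "v \<in> attached G (c ` {..<k})"
  then obtain l w where "l < k" "v = c l" "w \<in> verts G" "w \<notin> c ` {..<k}" "{v, w} \<in> edges G"
    by (auto simp: attached_def)
  then show "v \<in> {c i, c j}"
    using Theta_plus_free_no_pendant[OF assms, of l w] by blast
qed

definition edges_within :: "'a graph \<Rightarrow> 'a set \<Rightarrow> 'a set set" where
  "edges_within G S = {e \<in> edges G. e \<subseteq> S}"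

text \<open>Every edge inside \<open>S\<close> off the cycle is the chord of a Theta graph on the
  same cycle, so it must cover \<open>U\<close>. At most \<open>k - 3\<close> chords contain a given
  vertex and at most one contains two given vertices; the cycle itself adds \<open>k\<close>
  edges.\<close>

lemma theta_edge_bound:
  assumes k: "5 \<le> k" and G: "simple_graph G" "planar G" and free: "family_free (Theta_plus k) G"
    and th: "theta_at k G c i j" and S: "S = c ` {..<k}" and U: "U = attached G S"
  shows "card U \<le> 2"
    and "card (edges_within G S) + 6 \<le> 3 * k"
    and "U \<noteq> {} \<Longrightarrow> card (edges_within G S) + 3 \<le> 2 * k"
    and "2 \<le> card U \<Longrightarrow> card (edges_within G S) \<le> k + 1"
proof -
  have k3: "3 \<le> k" using k by simp
  have inj: "inj_on c {..<k}" and SV: "S \<subseteq> verts G"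
    using th by (auto simp: theta_at_def S)
  have cS: "card S = k" using inj by (simp add: S card_image)
  have finS: "finite S" by (simp add: S)
  define cyc where "cyc = (\<lambda>t. {c t, c (Suc t mod k)}) ` {..<k}"
  have ccyc: "finite cyc" "card cyc \<le> k"
    using card_image_le[of "{..<k}" "\<lambda>t. {c t, c (Suc t mod k)}"] by (auto simp: cyc_def)
  have U_sub: "U \<subseteq> {c i, c j}"
    unfolding U S by (rule attached_subset_chord[OF k3 free th])
  then have "card U \<le> card {c i, c j}" by (intro card_mono) auto
  then show "card U \<le> 2" using card_insert_le_m1[of 2 "{c j}" "c i"] by simp
  show "card (edges_within G S) + 6 \<le> 3 * k"
  proof -
    have "simple_graph (S, edges_within G S)"
      using G(1) finS by (auto simp: simple_graph_def edges_within_def)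
    moreover have "planar (S, edges_within G S)"
      by (rule planar_mono[OF G(2)]) (use SV in \<open>auto simp: edges_within_def\<close>)
    ultimately show ?thesis
      using planar_edge_bound[of "(S, edges_within G S)"] cS k by simp
  qed
  have chord: "\<exists>a b. e = {c a, c b} \<and> theta_at k G c a b" if e: "e \<in> edges_within G S" "e \<notin> cyc" for e
  proof -
    have e': "e \<in> edges G" "e \<subseteq> S" "card e = 2"
      using e(1) G(1) by (auto simp: edges_within_def simple_graph_def)
    then obtain x y where xy: "e = {x, y}" "x \<noteq> y" by (auto simp: card_2_iff)
    then obtain a b where ab: "a < k" "x = c a" "b < k" "y = c b"
      using e'(2) by (auto simp: S)
    have "b \<noteq> Suc a mod k" "a \<noteq> Suc b mod k"
      using e(2) xy(1) ab by (auto simp: cyc_def insert_commute)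
    moreover have "a \<noteq> b" using xy ab by auto
    ultimately have "theta_at k G c a b"
      using th ab xy(1) e'(1) by (simp add: theta_at_def)
    then show ?thesis using xy(1) ab by blast
  qed
  have chordU: "U \<subseteq> {c a, c b}" if "theta_at k G c a b" for a b
    unfolding U S by (rule attached_subset_chord[OF k3 free that])
  show "card (edges_within G S) \<le> k + 1" if "2 \<le> card U"
  proof -
    have "edges_within G S \<subseteq> insert U cyc"
    proof
      fix e assume e: "e \<in> edges_within G S"
      show "e \<in> insert U cyc"
      proof (cases "e \<in> cyc")
        case False
        then obtain a b where ab: "e = {c a, c b}" "theta_at k G c a b" using chord e by blast
        have "card {c a, c b} \<le> 2" using card_insert_le_m1[of 2 "{c b}" "c a"] by simp
        then have "U = {c a, c b}"
          using chordU[OF ab(2)] that by (intro card_seteq) auto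
        then show ?thesis using ab(1) by simp
      qed simp
    qed
    then have "card (edges_within G S) \<le> card (insert U cyc)"
      using ccyc(1) by (intro card_mono) auto
    also have "\<dots> \<le> Suc (card cyc)" using ccyc(1) by (simp add: card_insert_if)
    finally show ?thesis using ccyc(2) by simp
  qed
  show "card (edges_within G S) + 3 \<le> 2 * k" if ne: "U \<noteq> {}"
  proof -
    obtain u where "u \<in> U" using ne by blast
    then have "u \<in> S" by (auto simp: U attached_def)
    then obtain a where a: "a < k" "u = c a" by (auto simp: S)
    define a' where "a' = (if a = 0 then k - 1 else a - 1)"
    have a': "a' < k" "Suc a' mod k = a" "a' \<noteq> a" "a' \<noteq> Suc a mod k" "Suc a mod k \<noteq> a"
      using a(1) k by (auto simp: a'_def mod_Suc)
    \<comment> \<open>Positions where a chord at \<open>u\<close> can end: neither \<open>a\<close>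
      itself nor its two neighbours on the cycle.\<close>
    define B where "B = {..<k} - {a, a', Suc a mod k}"
    have "card {a, a', Suc a mod k} = 3"
      using a' by (auto simp: card_insert_if)
    then have "card B = k - 3"
      using a(1) a'(1) Suc_mod_less[OF a(1)] by (simp add: B_def card_Diff_subset)
    have "edges_within G S \<subseteq> cyc \<union> (\<lambda>b. {u, c b}) ` B"
    proof
      fix e assume e: "e \<in> edges_within G S"
      show "e \<in> cyc \<union> (\<lambda>b. {u, c b}) ` B"
      proof (cases "e \<in> cyc")
        case False
        then obtain x y where xy: "e = {c x, c y}" "theta_at k G c x y" using chord e by blast
        then have "x < k" "y < k" using th by (auto simp: theta_at_def)
        have "u \<in> {c x, c y}" using chordU[OF xy(2)] \<open>u \<in> U\<close> by blast
        then have "a = x \<or> a = y"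
          using inj a \<open>x < k\<close> \<open>y < k\<close> by (auto simp: inj_on_def)
        moreover have "z \<in> B" if "theta_at k G c a z \<or> theta_at k G c z a" for z
          using that a'(2) by (auto simp: B_def theta_at_def)
        ultimately show ?thesis
          using xy a(2) by (auto simp: insert_commute)
      qed simp
    qed
    then have "card (edges_within G S) \<le> card (cyc \<union> (\<lambda>b. {u, c b}) ` B)"
      using ccyc(1) by (intro card_mono) (auto simp: B_def)
    also have "\<dots> \<le> card cyc + card ((\<lambda>b. {u, c b}) ` B)"
      by (rule card_Un_le)
    also have "card ((\<lambda>b. {u, c b}) ` B) \<le> card B"
      by (rule card_image_le) (simp add: B_def)
    finally show ?thesis using ccyc(2) \<open>card B = k - 3\<close> k by simp
  qed
qed

section \<open>Gluing small blocks at a vertex\<close>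

text \<open>Minus the shared vertex \<open>u\<close>, a cycle is connected, so it stays on one side of \<open>u\<close>.\<close>

lemma no_theta_glue:
  assumes "\<not> has_theta k G" and G: "simple_graph G"
    and F: "\<And>e. e \<in> F \<Longrightarrow> e \<subseteq> W \<and> card e = 2" and W: "finite W" "card W < k" "W \<inter> verts G = {u}"
  shows "\<not> has_theta k (verts G \<union> W, edges G \<union> F)"
proof
  assume "has_theta k (verts G \<union> W, edges G \<union> F)"
  then obtain c i j where th: "theta_at k (verts G \<union> W, edges G \<union> F) c i j"
    by (auto simp: has_theta_def)
  have inj: "inj_on c {..<k}" and sub: "\<And>t. t < k \<Longrightarrow> c t \<in> verts G \<union> W"
    and step: "\<And>t. t < k \<Longrightarrow> {c t, c (Suc t mod k)} \<in> edges G \<union> F"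
    using th by (auto simp: theta_at_def)
  have k: "0 < k" using W(2) by simp
  have eV: "e \<subseteq> verts G" if "e \<in> edges G" for e
    using G that by (simp add: simple_graph_def)
  \<comment> \<open>\<open>P t\<close> puts position \<open>t\<close> strictly on the new side;
    \<open>u\<close> counts as old.\<close>
  define P where "P t \<longleftrightarrow> c t \<notin> verts G" for t
  have cross: "c t = u \<or> c (Suc t mod k) = u" if "t < k" "P t \<noteq> P (Suc t mod k)" for t
  proof -
    have "\<not> {c t, c (Suc t mod k)} \<subseteq> verts G" using that(2) by (auto simp: P_def)
    then have "{c t, c (Suc t mod k)} \<in> F" using step[OF that(1)] eV by (metis UnE)
    then have "{c t, c (Suc t mod k)} \<subseteq> W" using F by metis
    then show ?thesis using that(2) W(3) by (auto simp: P_def)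
  qed
  \<comment> \<open>Start at \<open>u\<close> if the cycle passes through it and anywhere otherwise;
    either way the positions \<open>b 1\<close> to \<open>b (k - 1)\<close> avoid
    \<open>u\<close>.\<close>
  obtain a where a: "a < k" "u \<in> c ` {..<k} \<Longrightarrow> c a = u"
  proof (cases "u \<in> c ` {..<k}")
    case True
    then show ?thesis using that by auto
  next
    case False
    then show ?thesis using that k by blast
  qed
  define b where "b m = (a + m) mod k" for m
  have b: "b m < k" "Suc (b m) mod k = b (Suc m)" for m
    using k by (simp_all add: b_def mod_Suc_eq)
  have notu: "c (b m) \<noteq> u" if "1 \<le> m" "m < k" for m
  proof
    assume "c (b m) = u"
    then have "c a = c (b m)" using a(2) b(1) by force
    then have "a = b m" using inj a(1) b(1) by (auto simp: inj_on_def)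
    then have "(a + m) mod k = a" by (simp add: b_def)
    then show False
      using that a(1) by (cases "a + m < k") (auto simp: le_mod_geq)
  qed
  have const: "P (b m) = P (b 1)" if "1 \<le> m" "m < k" for m
    using that
  proof (induction m rule: nat_induct_at_least)
    case (Suc m)
    then show ?case using cross[OF b(1)[of m]] notu[of m] notu[of "Suc m"] b(2)[of m] by auto
  qed simp
  have surj: "\<exists>m<k. t = b m" if "t < k" for t
  proof (cases "a \<le> t")
    case True
    then show ?thesis using that by (intro exI[of _ "t - a"]) (simp add: b_def)
  next
    case False
    then show ?thesis using that a(1) by (intro exI[of _ "t + k - a"]) (simp add: b_def)
  qed
  have "k \<noteq> 1"
    using th by (auto simp: theta_at_def)
  then have k1: "1 < k" using k by simp
  have allG: "c t \<in> verts G" if tk: "t < k" for t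
  proof (cases "P (b 1)")
    case True
    \<comment> \<open>On the new side the whole cycle would have to fit into \<open>W\<close>, which
      has fewer than \<open>k\<close> elements.\<close>
    have "c t \<in> W" if "t < k" for t
    proof -
      obtain m where m: "m < k" "t = b m" using surj[OF \<open>t < k\<close>] by blast
      show ?thesis
      proof (cases "m = 0")
        case False
        then have "P t" using const[of m] True m by simp
        then show ?thesis using sub[OF \<open>t < k\<close>] by (auto simp: P_def)
      next
        case m0: True
        show ?thesis
        proof (cases "P t")
          case True
          then show ?thesis using sub[OF \<open>t < k\<close>] by (auto simp: P_def)
        next
          case False
          then have "c t = u \<or> c (b 1) = u"
            using cross[OF \<open>t < k\<close>] True m m0 b(2)[of 0] by auto
          then show ?thesis using notu[of 1] k1 W(3) by auto
        qed
      qed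
    qed
    then have "c ` {..<k} \<subseteq> W" by auto
    then have "card (c ` {..<k}) \<le> card W" using W(1) by (rule card_mono[rotated])
    then show ?thesis using W(2) inj by (simp add: card_image)
  next
    case False
    obtain m where m: "m < k" "t = b m" using surj[OF tk] by blast
    have "\<not> P t"
    proof (cases "m = 0")
      case True
      show ?thesis
      proof
        assume "P t"
        then have "c t = u \<or> c (b 1) = u"
          using cross[OF tk] False m True b(2)[of 0] by auto
        then have "c t = u" using notu[of 1] k1 by auto
        then show False using \<open>P t\<close> W(3) by (auto simp: P_def)
      qed
    qed (use const[of m] False m in auto)
    then show ?thesis by (simp add: P_def)
  qed
  \<comment> \<open>An edge of \<open>F\<close> with both ends in \<open>G\<close> would lie in
    \<open>W \<inter> verts G\<close>, a single vertex. So the cycle edges and the chord are all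
    old.\<close>
  have edgeG: "{c x, c y} \<in> edges G" if "{c x, c y} \<in> edges G \<union> F" "x < k" "y < k" for x y
  proof (rule ccontr)
    assume "{c x, c y} \<notin> edges G"
    then have "{c x, c y} \<subseteq> W" "card {c x, c y} = 2" using that F by auto
    moreover have "{c x, c y} \<subseteq> verts G" using allG that by simp
    ultimately have "{c x, c y} \<subseteq> {u}" using W(3) by blast
    then show False using \<open>card {c x, c y} = 2\<close> card_mono[of "{u}" "{c x, c y}"] by simp
  qed
  have "{c t, c (Suc t mod k)} \<in> edges G" if "t < k" for t
    using edgeG[OF step[OF that] that Suc_mod_less[OF that]] .
  moreover have "{c i, c j} \<in> edges G"
    using edgeG[of i j] th by (auto simp: theta_at_def)
  ultimately have "theta_at k G c i j"
    using th allG unfolding theta_at_def by auto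
  then show False
    using assms(1) by (auto simp: has_theta_def)
qed

text \<open>The edges contributed by a block with \<open>n\<close> new vertices. For
  \<open>n >= 2\<close> the block is a triangulation on \<open>n + 1\<close> vertices, and
  \<open>3 * n - 3\<close> is \<open>3(n + 1) - 6\<close>.\<close>

definition book_gain :: "nat \<Rightarrow> nat" where
  "book_gain n = (if n = 0 then 0 else if n = 1 then 1 else 3 * n - 3)"

text \<open>The bound on \<open>card N\<close> keeps the block, which includes \<open>u\<close>,
  below \<open>k\<close> vertices. So it cannot hold a Theta graph, and gluing at the cut vertex
  \<open>u\<close> creates none elsewhere.\<close>

lemma glue_book:
  assumes G: "simple_graph G" "planar G" "\<not> has_theta k G" and u: "u \<in> verts G"
    and N: "finite N" "N \<inter> verts G = {}" "card N + 1 < k"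
  shows "\<exists>G'. simple_graph G' \<and> planar G' \<and> \<not> has_theta k G' \<and> verts G' = verts G \<union> N \<and>
    card (edges G') = card (edges G) + book_gain (card N)"
proof (cases "N = {}")
  case True
  then show ?thesis using G by (intro exI[of _ G]) (simp add: book_gain_def)
next
  case False
  define n where "n = card N"
  have n: "1 \<le> n" using False N(1) by (simp add: n_def Suc_le_eq card_gt_0_iff)
  obtain s where s: "bij_betw s {1..n} N"
    using ex_bij_betw_nat_finite_1[OF N(1)] by (auto simp: n_def)
  \<comment> \<open>Index 0, which the enumeration \<open>s\<close> of \<open>N\<close> leaves free,
    becomes the gluing vertex.\<close>
  define r where "r = s(0 := u)"
  have r0: "r 0 = u" by (simp add: r_def)
  have rN: "r ` {1..n} = N"
    using s by (auto simp: r_def bij_betw_def)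
  have rin: "r t \<in> N" if "1 \<le> t" "t \<le> n" for t
    using rN that by auto
  have inj: "inj_on r {..n}"
  proof (rule inj_onI)
    fix x y assume xy: "x \<in> {..n}" "y \<in> {..n}" "r x = r y"
    have pos: "x = y" if "1 \<le> x" "1 \<le> y"
    proof -
      have "s x = s y" using that xy(3) by (simp add: r_def)
      moreover have "x \<in> {1..n}" "y \<in> {1..n}" using that xy(1,2) by auto
      ultimately show ?thesis using bij_betw_imp_inj_on[OF s] by (meson inj_onD)
    qed
    have zero: "r 0 \<noteq> r t" if "1 \<le> t" "t \<le> n" for t
      using rin[OF that] r0 u N(2) by auto
    consider "x = 0" "y = 0" | "x = 0" "1 \<le> y" | "1 \<le> x" "y = 0" | "1 \<le> x" "1 \<le> y"
      by linarith
    then show "x = y"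
      using pos zero[of x] zero[of y] xy by cases auto
  qed
  define G' where "G' = (verts G \<union> N, edges G \<union> book_edges r n)"
  have planar: "planar G'"
    using planar_glue_book[OF G(1,2), of r n] r0 u inj rN N(2) by (simp add: G'_def)
  have pairs: "\<exists>x y. e = {r x, r y} \<and> x < y \<and> y \<le> n" if "e \<in> book_edges r n" for e
  proof -
    obtain x y where "(x, y) \<in> book_pairs n" "e = {r x, r y}"
      using \<open>e \<in> _\<close> by (auto simp: book_edges_def)
    then show ?thesis using book_pairs_less by blast
  qed
  have W: "e \<subseteq> insert u N \<and> card e = 2 \<and> e \<inter> N \<noteq> {}" if "e \<in> book_edges r n" for e
  proof -
    obtain x y where xy: "e = {r x, r y}" "x < y" "y \<le> n" using pairs[OF \<open>e \<in> _\<close>] by blast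
    have "r x \<noteq> r y" using inj xy by (auto simp: inj_on_def)
    moreover have "r y \<in> N" using rin[of y] xy by simp
    moreover have "r x \<in> insert u N" using rin[of x] xy r0 by (cases "x = 0") auto
    ultimately show ?thesis using xy(1) by auto
  qed
  have simple: "simple_graph G'"
    using G(1) W u N(1) unfolding simple_graph_def G'_def by auto
  have "\<not> has_theta k (verts G \<union> insert u N, edges G \<union> book_edges r n)"
  proof (rule no_theta_glue[OF G(3,1)])
    show "card (insert u N) < k"
      using N by (simp add: card_insert_if)
  qed (use W N u in auto)
  then have noth: "\<not> has_theta k G'"
    using u by (simp add: G'_def insert_absorb)
  have "card (edges G') = card (edges G) + card (book_edges r n)"
  proof -
    have "edges G \<inter> book_edges r n = {}"
    proof -
      have "e \<inter> N = {}" if "e \<in> edges G" for e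
        using G(1) N(2) that unfolding simple_graph_def by blast
      then show ?thesis using W by blast
    qed
    moreover have "finite (book_edges r n)"
      by (simp add: book_edges_def finite_book_pairs)
    ultimately show ?thesis
      using finite_edges[OF G(1)] by (simp add: G'_def card_Un_disjoint)
  qed
  also have "card (book_edges r n) = card (book_pairs n)"
    unfolding book_edges_def
  proof (rule card_image, rule inj_onI, clarify)
    fix x y x' y' assume *: "(x, y) \<in> book_pairs n" "(x', y') \<in> book_pairs n" "{r x, r y} = {r x', r y'}"
    have **: "x < y" "y \<le> n" "x' < y'" "y' \<le> n" using book_pairs_less * by blast+
    have "r x = r x' \<and> r y = r y' \<or> r x = r y' \<and> r y = r x'"
      using *(3) by (simp add: doubleton_eq_iff)
    moreover have "s = t" if "r s = r t" "s \<le> n" "t \<le> n" for s t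
      using inj that by (auto simp: inj_on_def)
    ultimately show "x = x' \<and> y = y'" using **
      by (metis less_imp_le_nat less_le_trans not_less_iff_gr_or_eq order_trans)
  qed
  also have "\<dots> = book_gain n"
    using n by (simp add: card_book_pairs book_gain_def)
  finally show ?thesis
    using planar simple noth by (intro exI[of _ G']) (simp add: n_def G'_def)
qed

section \<open>Replacing Theta graphs by blocks\<close>

lemma planar_isolated_vertex: "planar ({x}, {})"
  by (simp add: planar_def)

lemma simple_graph_isolated_vertex: "simple_graph ({x}, {})"
  by (simp add: simple_graph_def)

lemma no_theta_isolated_vertex: "\<not> has_theta k ({x}, {})"
  by (simp add: has_theta_def theta_at_def)

text \<open>An edge at an unattached vertex of \<open>S\<close> cannot leave \<open>S\<close>, so
  deleting these vertices costs only edges inside \<open>S\<close>.\<close>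

lemma edges_delete_unattached:
  assumes G: "simple_graph G" and D: "D = S - attached G S"
  shows "card (edges G) \<le> card {e \<in> edges G. e \<inter> D = {}} + card (edges_within G S)"
proof -
  have "e \<subseteq> S" if e: "e \<in> edges G" "e \<inter> D \<noteq> {}" for e
  proof -
    obtain v where v: "v \<in> e" "v \<in> D" using e(2) by blast
    obtain w where w: "e = {v, w}" "w \<in> verts G"
      using edge_other_end[OF G e(1) v(1)] by metis
    then show ?thesis
      using v(2) e(1) by (auto simp: D attached_def)
  qed
  then have "edges G \<subseteq> {e \<in> edges G. e \<inter> D = {}} \<union> edges_within G S"
    by (auto simp: edges_within_def)
  then have "card (edges G) \<le> card ({e \<in> edges G. e \<inter> D = {}} \<union> edges_within G S)"
    using finite_edges[OF G] by (intro card_mono) (auto simp: edges_within_def)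
  also have "\<dots> \<le> card {e \<in> edges G. e \<inter> D = {}} + card (edges_within G S)"
    by (rule card_Un_le)
  finally show ?thesis .
qed

lemma family_free_mono:
  assumes "family_free \<F> G" "verts H \<subseteq> verts G" "edges H \<subseteq> edges G"
  shows "family_free \<F> H"
proof -
  have "contains G F" if "contains H F" for F
    using that assms(2,3) unfolding contains_def by (meson order_trans subsetD)
  then show ?thesis
    using assms(1) by (auto simp: family_free_def)
qed

lemma split_card:
  assumes "finite A" "a \<le> card A"
  obtains B C where "A = B \<union> C" "B \<inter> C = {}" "card B = a" "card C = card A - a" "finite B" "finite C"
proof -
  obtain B where B: "B \<subseteq> A" "card B = a" "finite B"
    using obtain_subset_with_card_n[OF assms(2)] by metis
  then show thesis
    using that[of B "A - B"] assms(1) by (auto simp: card_Diff_subset)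
qed

lemma book_gain_block:
  assumes "5 \<le> k"
  shows "book_gain (k - 2) = 3 * k - 9"
proof -
  have "k - 2 \<noteq> 0" "k - 2 \<noteq> 1" "3 * (k - 2) - 3 = 3 * k - 9"
    using assms by linarith+
  then show ?thesis
    unfolding book_gain_def by metis
qed

text \<open>Deleted vertices are recycled in the new blocks, so the vertex set stays the same and no
  fresh elements of \<open>'a\<close> are needed.\<close>

lemma theta_free_improvement:
  fixes G :: "'a graph"
  assumes k: "5 \<le> k"
  shows "simple_graph G \<Longrightarrow> planar G \<Longrightarrow> family_free (Theta_plus k) G \<Longrightarrow> verts G \<noteq> {} \<Longrightarrow> card (verts G) \<noteq> k \<Longrightarrow>
    \<exists>G' :: 'a graph. simple_graph G' \<and> planar G' \<and> \<not> has_theta k G' \<and> verts G' = verts G \<and> card (edges G) \<le> card (edges G')"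
proof (induction "card (verts G)" arbitrary: G rule: less_induct)
  case less
  note G = less.prems
  have finV: "finite (verts G)" using G(1) by (simp add: simple_graph_def)
  show ?case
  proof (cases "has_theta k G")
    case False
    then show ?thesis using G by blast
  next
    case True
    then obtain c i j where th: "theta_at k G c i j" by (auto simp: has_theta_def)
    define S where "S = c ` {..<k}"
    define U where "U = attached G S"
    define D where "D = S - U"
    define u where "u = card U"
    have inj: "inj_on c {..<k}" and SV: "S \<subseteq> verts G"
      using th by (auto simp: theta_at_def S_def)
    have cS: "card S = k" and finS: "finite S"
      using inj by (simp_all add: S_def card_image)
    have US: "U \<subseteq> S" by (auto simp: U_def attached_def)
    have finU: "finite U" using US finS finite_subset by blast
    note bound = theta_edge_bound[OF k G(1-3) th S_def U_def]
    have u2: "u \<le> 2" using bound(1) by (simp add: u_def)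
    have bS: "card (edges_within G S) \<le> (if u = 0 then 3 * k - 6 else if u = 1 then 2 * k - 3 else k + 1)"
    proof -
      consider "u = 0" | "u = 1" | "u = 2" using u2 by linarith
      then show ?thesis
      proof cases
        case 2
        then have "U \<noteq> {}" by (auto simp: u_def)
        then show ?thesis using bound(3) 2 by simp
      qed (use bound(2,4) in \<open>simp_all add: u_def\<close>)
    qed
    have DV: "D \<subseteq> verts G" using SV by (auto simp: D_def)
    have finD: "finite D" using finS by (simp add: D_def)
    have cD: "card D = k - u"
      using US finU cS by (simp add: D_def u_def card_Diff_subset)
    define G0 where "G0 = (verts G - D, {e \<in> edges G. e \<inter> D = {}})"
    have G0V: "verts G0 = verts G - D" and G0E: "edges G0 = {e \<in> edges G. e \<inter> D = {}}"
      by (simp_all add: G0_def)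
    have eE: "card (edges G) \<le> card (edges G0) + card (edges_within G S)"
      using edges_delete_unattached[OF G(1), of D S] by (simp add: D_def U_def G0E)
    have sub0: "verts G0 \<subseteq> verts G" "edges G0 \<subseteq> edges G"
      by (auto simp: G0V G0E)
    have simple0: "simple_graph G0"
      using G(1) by (auto simp: simple_graph_def G0V G0E)
    have planar0: "planar G0"
      by (rule planar_mono[OF G(2) sub0]) (use simple0 in \<open>auto simp: simple_graph_def\<close>)
    have free0: "family_free (Theta_plus k) G0"
      by (rule family_free_mono[OF G(3) sub0])
    \<comment> \<open>Here \<open>card (verts G) \<noteq> k\<close> is used: some vertex must remain
      to glue at.\<close>
    have ne0: "verts G0 \<noteq> {}"
    proof
      assume "verts G0 = {}"
      then have "verts G = S" using SV by (auto simp: G0V D_def)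
      then show False using cS G(5) by simp
    qed
    have VD: "verts G = verts G0 \<union> D" "verts G0 \<inter> D = {}"
      using DV by (auto simp: G0V)
    have cV: "card (verts G) = card (verts G0) + card D"
      using VD finV finD by (metis card_Un_disjoint finite_Un)
    have D3: "k - 2 \<le> card D" using cD u2 k by simp
    show ?thesis
    proof (cases "has_theta k G0 \<and> card (verts G0) = k")
      case False
      have "card (verts G0) < card (verts G)"
        using cV D3 k by simp
      \<comment> \<open>In this case a \<open>G0\<close> on exactly \<open>k\<close> vertices has no
        Theta graph and serves as \<open>G1\<close> itself; any other \<open>G0\<close> is covered
        by the induction.\<close>
      then obtain G1 where G1: "simple_graph G1" "planar G1" "\<not> has_theta k G1" "verts G1 = verts G0"
        "card (edges G0) \<le> card (edges G1)"
        using less.hyps[OF _ simple0 planar0 free0 ne0] False simple0 planar0 by blast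
      obtain x where x: "x \<in> verts G0" using ne0 by blast
      \<comment> \<open>\<open>A\<close> and \<open>x\<close> together give \<open>k - 1\<close>
        vertices; \<open>B\<close> receives the \<open>2 - u\<close> vertices left over.\<close>
      obtain A B where AB: "D = A \<union> B" "A \<inter> B = {}" "card A = k - 2" "card B = card D - (k - 2)" "finite A" "finite B"
        by (rule split_card[OF finD D3])
      have cB: "card B = 2 - u" using AB(4) cD u2 k by simp
      obtain G2 where G2: "simple_graph G2" "planar G2" "\<not> has_theta k G2" "verts G2 = verts G1 \<union> A"
        "card (edges G2) = card (edges G1) + book_gain (card A)"
      proof -
        have "x \<in> verts G1" "finite A" "A \<inter> verts G1 = {}" "card A + 1 < k"
          using x AB VD(2) k G1(4) by auto
        then show thesis
          using glue_book[OF G1(1-3)] that by blast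
      qed
      obtain G3 where G3: "simple_graph G3" "planar G3" "\<not> has_theta k G3" "verts G3 = verts G2 \<union> B"
        "card (edges G3) = card (edges G2) + book_gain (card B)"
      proof -
        have "x \<in> verts G2" "finite B" "B \<inter> verts G2 = {}" "card B + 1 < k"
          using x AB VD(2) k G1(4) G2(4) cB by auto
        then show thesis
          using glue_book[OF G2(1-3)] that by blast
      qed
      have "verts G3 = verts G"
        using G3(4) G2(4) G1(4) AB(1) VD(1) by auto
      moreover have "card (edges G) \<le> card (edges G3)"
      proof -
        have A: "book_gain (card A) = 3 * k - 9"
          using AB(3) k by (simp add: book_gain_block)
        have B: "book_gain (card B) = (if u = 0 then 3 else if u = 1 then 1 else 0)"
          using cB u2 by (auto simp: book_gain_def)
        \<comment> \<open>The cases read \<open>3k - 6 = (3k - 9) + 3\<close>,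
          \<open>2k - 3 <= (3k - 9) + 1\<close> and \<open>k + 1 <= 3k - 9\<close>; the last two are
          tight at \<open>k = 5\<close>.\<close>
        consider "u = 0" | "u = 1" | "u = 2" using u2 by linarith
        then have "card (edges_within G S) \<le> book_gain (card A) + book_gain (card B)"
          using bS k unfolding A B by cases simp_all
        then show ?thesis
          using eE G1(5) G2(5) G3(5) by linarith
      qed
      ultimately show ?thesis using G3 by blast
    next
      case True
      then obtain c' i' j' where th': "theta_at k G0 c' i' j'" by (auto simp: has_theta_def)
      have cV0: "card (verts G0) = k" using True by simp
      have "c' ` {..<k} \<subseteq> verts G0" "card (c' ` {..<k}) = k"
        using th' by (auto simp: theta_at_def card_image)
      then have im': "c' ` {..<k} = verts G0"
        using cV0 finV sub0(1) finite_subset by (metis card_subset_eq)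
      have thG: "theta_at k G c' i' j'"
        using th' sub0 by (auto simp: theta_at_def)
      define U' where "U' = attached G (verts G0)"
      note bound' = theta_edge_bound[OF k G(1-3) thG im'[symmetric] U'_def]
      \<comment> \<open>A vertex of \<open>U\<close> is an end of the chord; its successor on the
        cycle is not, hence lies in \<open>D\<close>. So the vertex is attached in
        \<open>verts G0\<close> as well, and the sharper bounds hold for \<open>G0\<close> too. With
        \<open>3k - 6\<close> for \<open>G0\<close> instead, the count for \<open>u > 0\<close>
        would fail at \<open>k = 5\<close>.\<close>
      have "U \<subseteq> U'"
      proof
        fix v assume v: "v \<in> U"
        have chord: "U \<subseteq> {c i, c j}"
          unfolding U_def S_def using attached_subset_chord[OF _ G(3) th] k by simp
        have *: "c (Suc a mod k) \<in> D" if "a = i \<or> a = j" for a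
        proof -
          have ij: "i < k" "j < k" "j \<noteq> Suc i mod k" "i \<noteq> Suc j mod k"
            using th by (simp_all add: theta_at_def)
          then have "a < k" using that by auto
          then have "Suc a mod k \<noteq> a" "Suc a mod k < k"
            using k Suc_mod_less by (auto simp: mod_Suc)
          moreover have "Suc a mod k \<noteq> i" "Suc a mod k \<noteq> j"
            using that ij calculation(1) by auto
          ultimately have "c (Suc a mod k) \<in> S" "c (Suc a mod k) \<noteq> c i" "c (Suc a mod k) \<noteq> c j"
            using inj_on_eq_iff[OF inj] ij by (simp_all add: S_def)
          then show ?thesis using chord by (auto simp: D_def)
        qed
        obtain a where a: "a = i \<or> a = j" "v = c a" using v chord by blast
        have "a < k" using a(1) th by (auto simp: theta_at_def)
        then have "{v, c (Suc a mod k)} \<in> edges G" using th a(2) by (simp add: theta_at_def)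
        moreover have "c (Suc a mod k) \<in> verts G - verts G0" using *[OF a(1)] VD by blast
        moreover have "v \<in> verts G0" using v US SV by (auto simp: G0V D_def)
        ultimately show "v \<in> U'" by (auto simp: U'_def attached_def)
      qed
      moreover have "finite U'"
        using finV sub0(1) by (auto simp: U'_def attached_def intro: finite_subset)
      ultimately have uU': "u \<le> card U'" "U \<noteq> {} \<Longrightarrow> U' \<noteq> {}"
        by (auto simp: u_def card_mono)
      have "edges_within G (verts G0) = edges G0"
        using simple0 by (auto simp: edges_within_def G0V G0E simple_graph_def) 
      then have b0: "card (edges G0) \<le> (if u = 0 then 3 * k - 6 else if u = 1 then 2 * k - 3 else k + 1)"
      proof -
        consider "u = 0" | "u = 1" | "u = 2" using u2 by linarith
        then show ?thesis
        proof cases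
          case 2
          then have "U \<noteq> {}" by (auto simp: u_def)
          then show ?thesis using bound'(3) uU'(2) 2 \<open>edges_within G _ = _\<close> by simp
        qed (use bound'(2,4) uU'(1) \<open>edges_within G _ = _\<close> in simp_all)
      qed
      obtain x where x: "x \<in> verts G0" using ne0 by blast
      \<comment> \<open>The induction does not cover this \<open>G0\<close>, so nothing of it is
        kept except \<open>x\<close>. The other \<open>2k - u - 1\<close> vertices form two blocks
        with \<open>k - 2\<close> new vertices each and one with \<open>3 - u\<close>.\<close>
      define R where "R = verts G - {x}"
      have xV: "x \<in> verts G" using x sub0 by blast
      have finR: "finite R" using finV by (simp add: R_def)
      have cR: "card R = (k - 2) + ((k - 2) + (3 - u))"
        using cV cV0 cD u2 k xV finV by (simp add: R_def)
      obtain A R' where A: "R = A \<union> R'" "A \<inter> R' = {}" "card A = k - 2" "card R' = card R - (k - 2)" "finite A" "finite R'"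
        by (rule split_card[OF finR, of "k - 2"]) (use cR in simp)
      have "k - 2 \<le> card R'" using A(4) cR by simp
      then obtain B C where B: "R' = B \<union> C" "B \<inter> C = {}" "card B = k - 2" "card C = card R' - (k - 2)" "finite B" "finite C"
        by (rule split_card[OF A(6)])
      have cC: "card C = 3 - u" using B(4) A(4) cR by simp
      have xR: "x \<notin> A" "x \<notin> B" "x \<notin> C" using A(1) B(1) by (auto simp: R_def)
      obtain G1 where G1: "simple_graph G1" "planar G1" "\<not> has_theta k G1" "verts G1 = {x} \<union> A"
        "card (edges G1) = book_gain (card A)"
      proof -
        have "x \<in> verts ({x}, {} :: 'a set set)" "finite A" "A \<inter> verts ({x}, {} :: 'a set set) = {}" "card A + 1 < k"
          using xR A k by auto
        from glue_book[OF simple_graph_isolated_vertex planar_isolated_vertex no_theta_isolated_vertex this]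
        show thesis using that unfolding fst_conv snd_conv card.empty add_0 by blast
      qed
      obtain G2 where G2: "simple_graph G2" "planar G2" "\<not> has_theta k G2" "verts G2 = verts G1 \<union> B"
        "card (edges G2) = card (edges G1) + book_gain (card B)"
      proof -
        have "x \<in> verts G1" "finite B" "B \<inter> verts G1 = {}" "card B + 1 < k"
          using xR A B k G1(4) by auto
        then show thesis
          using glue_book[OF G1(1-3)] that by blast
      qed
      obtain G3 where G3: "simple_graph G3" "planar G3" "\<not> has_theta k G3" "verts G3 = verts G2 \<union> C"
        "card (edges G3) = card (edges G2) + book_gain (card C)"
      proof -
        \<comment> \<open>The last block has at most four vertices, one less than the least
          \<open>k\<close>.\<close>
        have "x \<in> verts G2" "finite C" "C \<inter> verts G2 = {}" "card C + 1 < k"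
          using xR A B k G1(4) G2(4) cC by auto
        then show thesis
          using glue_book[OF G2(1-3)] that by blast
      qed
      have "verts G3 = {x} \<union> R"
        using G3(4) G2(4) G1(4) A(1) B(1) by auto
      then have "verts G3 = verts G" using xV by (auto simp: R_def)
      moreover have "card (edges G) \<le> card (edges G3)"
      proof -
        have AB: "book_gain (card A) = 3 * k - 9" "book_gain (card B) = 3 * k - 9"
          using A(3) B(3) k by (simp_all add: book_gain_block)
        have C: "book_gain (card C) = (if u = 0 then 6 else if u = 1 then 3 else 1)"
          using cC u2 by (auto simp: book_gain_def)
        \<comment> \<open>\<open>G0\<close> and \<open>S\<close> obey the same bound, so the losses
          add up to at most \<open>6k - 12\<close>, \<open>4k - 6\<close> or \<open>2k + 2\<close>,
          against gains of \<open>6k - 12\<close>, \<open>6k - 15\<close> and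
          \<open>6k - 17\<close>.\<close>
        consider "u = 0" | "u = 1" | "u = 2" using u2 by linarith
        then have "card (edges G0) + card (edges_within G S) \<le>
            book_gain (card A) + book_gain (card B) + book_gain (card C)"
          using bS b0 k unfolding AB C by cases simp_all
        then show ?thesis
          using eE G1(5) G2(5) G3(5) by linarith
      qed
      ultimately show ?thesis using G3 by blast
    qed
  qed
qed

theorem theorem5p2:
  fixes n k :: nat
  assumes "n \<ge> k + 1" and "k \<ge> 5"
  shows "ex_planar n (Theta_plus k) = ex_planar n (Theta k)"
proof -
  define \<G> where "\<G> \<F> = {G :: nat graph. simple_graph G \<and> card (verts G) = n \<and> planar G \<and> family_free \<F> G}"
    for \<F> :: "nat graph set"
  define M where "M \<F> = (card \<circ> edges) ` \<G> \<F>" for \<F> :: "nat graph set"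
  have ex: "ex_planar n \<F> = Max (M \<F>)" for \<F> :: "nat graph set"
    unfolding ex_planar_def M_def \<G>_def setcompr_eq_image comp_def by (rule refl)
  have k3: "3 \<le> k" using assms(2) by simp
  \<comment> \<open>A crude bound is enough: it makes the sets finite, so that \<open>Max\<close> is
    a true maximum.\<close>
  have "M \<F> \<subseteq> {..2 ^ n}" for \<F> :: "nat graph set"
  proof
    fix m assume "m \<in> M \<F>"
    then obtain G :: "nat graph" where G: "m = card (edges G)" "simple_graph G" "card (verts G) = n"
      unfolding M_def \<G>_def comp_def image_iff by blast
    then have "edges G \<subseteq> Pow (verts G)" "finite (verts G)"
      by (auto simp: simple_graph_def)
    then have "m \<le> card (Pow (verts G))"
      unfolding G(1) by (intro card_mono) auto
    then show "m \<in> {..2 ^ n}"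
      using G(3) \<open>finite (verts G)\<close> by (simp add: card_Pow)
  qed
  then have fin: "finite (M \<F>)" for \<F> :: "nat graph set"
    by (meson finite_atMost finite_subset)
  have sub: "M (Theta k) \<subseteq> M (Theta_plus k)"
    using Theta_plus_free_if_Theta_free by (auto simp: M_def \<G>_def)
  have improve: "\<exists>m'\<in>M (Theta k). m \<le> m'" if m: "m \<in> M (Theta_plus k)" for m
  proof -
    obtain G :: "nat graph" where G: "m = card (edges G)" "simple_graph G" "card (verts G) = n" "planar G" "family_free (Theta_plus k) G"
      using m unfolding M_def \<G>_def comp_def image_iff by blast
    have "verts G \<noteq> {}" "card (verts G) \<noteq> k" using G(3) assms(1) by auto
    from theta_free_improvement[OF assms(2) G(2,4,5) this] obtain G' where "simple_graph G'" "planar G'" "\<not> has_theta k G'" "verts G' = verts G"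
      "card (edges G) \<le> card (edges G')"
      by blast
    then have "G' \<in> \<G> (Theta k)" "m \<le> card (edges G')"
      using G(1,3) by (simp_all add: \<G>_def family_free_Theta_iff[OF k3])
    then show ?thesis
      unfolding M_def by auto
  qed
  have "Max (M (Theta_plus k)) = Max (M (Theta k))"
  proof (cases "M (Theta_plus k) = {}")
    \<comment> \<open>\<open>Max\<close> of the empty set has no useful value, but here both sets
      are empty and hence equal.\<close>
    case True
    then show ?thesis using sub by simp
  next
    case False
    then have ne: "M (Theta k) \<noteq> {}" using improve by blast
    show ?thesis
    proof (rule antisym)
      show "Max (M (Theta_plus k)) \<le> Max (M (Theta k))"
        using improve[OF Max_in[OF fin False]] Max_ge[OF fin] by (meson order_trans)
      show "Max (M (Theta k)) \<le> Max (M (Theta_plus k))"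
        using sub ne fin by (rule Max_mono)
    qed
  qed
  then show ?thesis
    by (simp only: ex)
qed

end
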